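(* Let $\Omega\subset\mathbb{R}^{2n+1}$ be a bounded open set and let $u,v\in C^2(\overline{\Omega})$ be such that $u+v$ is $\sigma_2(\mathcal{H})$-convex in $\Omega$, $v=u$ on $\partial\Omega$, and $v<u$ in $\Omega$. Then $$\int_\Omega \left\{\sigma_2(\mathcal{H}(u))+12\,n\,(\partial_t u)^2\right\}dz\leq \int_\Omega \left\{\sigma_2(\mathcal{H}(v))+12\,n\,(\partial_t v)^2\right\}dz,$$ and $$\int_\Omega \operatorname{trace}\mathcal{H}(u)\,dz\leq \int_\Omega \operatorname{trace}\mathcal{H}(v)\,dz .$$
   Context: Let $n\ge 1$ and write points of $\mathbb{R}^{2n+1}$ (the Heisenberg group $\mathbb{H}^n$) as $(x,y,t)\in\mathbb{R}^n\times\mathbb{R}^n\times\mathbb{R}$; $dz$ is Lebesgue measure on $\mathbb{R}^{2n+1}$. The Heisenberg vector fields are $$X_j=\partial_{x_j}+2y_j\,\partial_t,\qquad X_{n+j}=\partial_{y_j}-2x_j\,\partial_t,\qquad j=1,\dots,n.$$ For a $C^2$ function $u$, $\mathcal{H}(u)$ is the $2n\times 2n$ symmetric matrix $\mathcal{H}(u)=\left[\frac{X_iX_ju+X_jX_iu}{2}\right]_{i,j=1}^{2n}$, and $\sigma_2(\mathcal{H}(u))$ is the second elementary symmetric function of its eigenvalues: $$\sigma_2(\mathcal{H}(u))=\sum_{1\le i<j\le 2n}\left\{X_i^2u\,X_j^2u-\left(\frac{X_iX_ju+X_jX_iu}{2}\right)^2\right\}.$$ A function $u\in C^2(\Omega)$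 is $\sigma_2(\mathcal{H})$-convex in $\Omega$ if $\operatorname{trace}\mathcal{H}(u)\ge 0$ and $\sigma_2(\mathcal{H}(u))\ge 0$ in $\Omega$. *)

theory Defs
  imports "HOL-Analysis.Analysis"
begin

text \<open>Points of the Heisenberg group are triples \<open>(x, y, t)\<close>; the dimension \<open>n\<close> is \<open>CARD('n)\<close>.\<close>

type_synonym 'n heis = "(real^'n) \<times> (real^'n) \<times> real"

definition partial_deriv :: "'a::real_normed_vector \<Rightarrow> ('a \<Rightarrow> real) \<Rightarrow> 'a \<Rightarrow> real" where
  "partial_deriv e u z = deriv (\<lambda>s. u (z + s *\<^sub>R e)) 0"

definition dx :: "'n::finite \<Rightarrow> ('n heis \<Rightarrow> real) \<Rightarrow> 'n heis \<Rightarrow> real" where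
  "dx j = partial_deriv (axis j 1, 0, 0)"

definition dy :: "'n::finite \<Rightarrow> ('n heis \<Rightarrow> real) \<Rightarrow> 'n heis \<Rightarrow> real" where
  "dy j = partial_deriv (0, axis j 1, 0)"

definition dt :: "('n::finite heis \<Rightarrow> real) \<Rightarrow> 'n heis \<Rightarrow> real" where
  "dt = partial_deriv (0, 0, 1)"

text \<open>
  The \<open>2n\<close> indices are the elements of \<open>'n + 'n\<close>: \<open>Inl j\<close> stands for \<open>j\<close>, and
  \<open>Inr j\<close> for \<open>n + j\<close>.
\<close>

fun heis_field :: "'n::finite + 'n \<Rightarrow> ('n heis \<Rightarrow> real) \<Rightarrow> 'n heis \<Rightarrow> real" where
  "heis_field (Inl j) u = (\<lambda>(x, y, t). dx j u (x, y, t) + 2 * y $ j * dt u (x, y, t))"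
| "heis_field (Inr j) u = (\<lambda>(x, y, t). dy j u (x, y, t) - 2 * x $ j * dt u (x, y, t))"

definition heis_hessian ::
    "('n::finite heis \<Rightarrow> real) \<Rightarrow> 'n heis \<Rightarrow> real^('n + 'n)^('n + 'n)" where
  "heis_hessian u z =
    (\<chi> i j. (heis_field i (heis_field j u) z + heis_field j (heis_field i u) z) / 2)"

text \<open>
  The order \<open>1 < \<dots> < 2n\<close> on the indices. The library has no order on sum types.
\<close>

fun index_less :: "'n::linorder + 'n \<Rightarrow> 'n + 'n \<Rightarrow> bool" where
  "index_less (Inl i) (Inl j) \<longleftrightarrow> i < j"
| "index_less (Inl i) (Inr j) \<longleftrightarrow> True"
| "index_less (Inr i) (Inl j) \<longleftrightarrow> False"
| "index_less (Inr i) (Inr j) \<longleftrightarrow> i < j"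

text \<open>
  For symmetric \<open>A\<close> this is the second elementary symmetric function of the eigenvalues of \<open>A\<close>,
  written as the sum of the principal \<open>2 \<times> 2\<close> minors.
\<close>

definition sigma2 :: "real^('n::{finite,linorder} + 'n)^('n + 'n) \<Rightarrow> real" where
  "sigma2 A = (\<Sum>(i, j) \<in> {(i, j). index_less i j}. A $ i $ i * A $ j $ j - (A $ i $ j)\<^sup>2)"

definition C2_on :: "'a::real_normed_vector set \<Rightarrow> ('a \<Rightarrow> real) \<Rightarrow> bool" where
  "C2_on \<Omega> u \<longleftrightarrow>
    (\<exists>(u' :: 'a \<Rightarrow> 'a \<Rightarrow>\<^sub>L real) (u'' :: 'a \<Rightarrow> 'a \<Rightarrow>\<^sub>L 'a \<Rightarrow>\<^sub>L real).
      (\<forall>z\<in>\<Omega>. (u has_derivative blinfun_apply (u' z)) (at z)) \<and>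
      (\<forall>z\<in>\<Omega>. (u' has_derivative blinfun_apply (u'' z)) (at z)) \<and>
      continuous_on \<Omega> u'')"

text \<open>
  \<open>C\<^sup>2\<close> up to the boundary, for open \<open>\<Omega>\<close>: \<open>u\<close> is \<open>C\<^sup>2\<close> in \<open>\<Omega>\<close> and continuous on the closure,
  and its first and second derivatives in \<open>\<Omega>\<close> extend continuously to the closure. Outside \<open>\<Omega>\<close>,
  the functions \<open>u'\<close> and \<open>u''\<close> are these extensions; no derivative of \<open>u\<close> is assumed to exist there.
\<close>

definition C2_on_closure :: "'a::real_normed_vector set \<Rightarrow> ('a \<Rightarrow> real) \<Rightarrow> bool" where
  "C2_on_closure \<Omega> u \<longleftrightarrow>
    (\<exists>(u' :: 'a \<Rightarrow> 'a \<Rightarrow>\<^sub>L real) (u'' :: 'a \<Rightarrow> 'a \<Rightarrow>\<^sub>L 'a \<Rightarrow>\<^sub>L real).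
      (\<forall>z\<in>\<Omega>. (u has_derivative blinfun_apply (u' z)) (at z)) \<and>
      (\<forall>z\<in>\<Omega>. (u' has_derivative blinfun_apply (u'' z)) (at z)) \<and>
      continuous_on (closure \<Omega>) u \<and>
      continuous_on (closure \<Omega>) u' \<and>
      continuous_on (closure \<Omega>) u'')"

definition sigma2_convex :: "'n::{finite,linorder} heis set \<Rightarrow> ('n heis \<Rightarrow> real) \<Rightarrow> bool" where
  "sigma2_convex \<Omega> u \<longleftrightarrow>
    C2_on \<Omega> u \<and>
    (\<forall>z\<in>\<Omega>. trace (heis_hessian u z) \<ge> 0 \<and> sigma2 (heis_hessian u z) \<ge> 0)"

end

theory Submission
  imports Defs
begin

text \<open>
  Put \<open>w = u - v\<close> and \<open>U = u + v\<close>. As \<open>\<sigma>\<^sub>2\<close> is quadratic, polarization and the commutators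
  \<open>[X\<^sub>j, X\<^sub>n\<^sub>+\<^sub>j] = - 4 \<partial>\<^sub>t\<close> show that the difference of the two integrands is
  \<open>\<Sum>i j. A\<^sub>i\<^sub>j X\<^sub>i X\<^sub>j w\<close> for a matrix \<open>A\<close> that depends linearly on the second derivatives of \<open>U\<close>,
  has divergence \<open>\<Sum>i. X\<^sub>i A\<^sub>i\<^sub>j = 0\<close> in the weak sense, and is positive semidefinite by
  \<open>\<sigma>\<^sub>2\<close>-convexity of \<open>U\<close>. Testing against \<open>\<phi>(w) X\<^sub>j w\<close>, with \<open>\<phi>\<close> nondecreasing and zero near \<open>0\<close>
  so that no regularity of the boundary is needed, gives
  \<open>\<integral> \<phi>(w) \<Sum>i j. A\<^sub>i\<^sub>j X\<^sub>i X\<^sub>j w = - \<integral> \<phi>'(w) \<Sum>i j. A\<^sub>i\<^sub>j X\<^sub>i w X\<^sub>j w \<le> 0\<close>, and \<open>\<phi>\<close> is let tend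
  to \<open>1\<close>. The trace inequality is the case where \<open>A\<close> is the identity.
\<close>

section \<open>Continuously differentiable functions\<close>

text \<open>The derivative is a plain function of point and direction, continuous in the point for
  each fixed direction. In finite dimension this is ordinary C^1, and products and zero extensions
  keep an explicit derivative.\<close>

definition C1_with ::
    "'a::real_normed_vector set \<Rightarrow> ('a \<Rightarrow> real) \<Rightarrow> ('a \<Rightarrow> 'a \<Rightarrow> real) \<Rightarrow> bool" where
  "C1_with S f f' \<longleftrightarrow>
    (\<forall>z\<in>S. (f has_derivative f' z) (at z)) \<and> (\<forall>h. continuous_on S (\<lambda>z. f' z h))"

lemma C1_withI:
  assumes "\<And>z. z \<in> S \<Longrightarrow> (f has_derivative f' z) (at z)"
    and "\<And>h. continuous_on S (\<lambda>z. f' z h)"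
  shows "C1_with S f f'"
  using assms by (auto simp: C1_with_def)

lemma C1_withD:
  assumes "C1_with S f f'"
  shows C1_with_deriv: "z \<in> S \<Longrightarrow> (f has_derivative f' z) (at z)"
    and C1_with_cont_deriv: "continuous_on S (\<lambda>z. f' z h)"
    and C1_with_cont: "continuous_on S f"
proof -
  show 1: "z \<in> S \<Longrightarrow> (f has_derivative f' z) (at z)" for z
    using assms unfolding C1_with_def by blast
  show "continuous_on S (\<lambda>z. f' z h)"
    using assms unfolding C1_with_def by blast
  show "continuous_on S f"
    using 1 has_derivative_at_withinI has_derivative_continuous_on by metis
qed

lemma C1_with_linear:
  assumes "C1_with S f f'" "z \<in> S"
  shows "f' z (a + b) = f' z a + f' z b" "f' z (c *\<^sub>R a) = c * f' z a"
    "f' z (a - b) = f' z a - f' z b" "f' z 0 = 0"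
proof -
  have "linear (f' z)"
    using assms by (auto simp: C1_with_def dest: has_derivative_linear)
  then show "f' z (a + b) = f' z a + f' z b" "f' z (c *\<^sub>R a) = c * f' z a"
    "f' z (a - b) = f' z a - f' z b" "f' z 0 = 0"
    by (auto simp: linear_add linear_scale linear_diff linear_0)
qed

lemma C1_with_subset: "C1_with S f f' \<Longrightarrow> T \<subseteq> S \<Longrightarrow> C1_with T f f'"
  by (auto simp: C1_with_def intro: continuous_on_subset)

lemma C1_with_mult:
  assumes "C1_with S f f'" "C1_with S g g'"
  shows "C1_with S (\<lambda>z. f z * g z) (\<lambda>z h. f z * g' z h + f' z h * g z)"
  by (intro C1_withI continuous_intros has_derivative_mult
        C1_with_cont[OF assms(1)] C1_with_cont[OF assms(2)]
        C1_with_cont_deriv[OF assms(1)] C1_with_cont_deriv[OF assms(2)]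
        C1_with_deriv[OF assms(1)] C1_with_deriv[OF assms(2)])

lemma C1_with_translate:
  assumes "C1_with S f f'"
  shows "C1_with {z. z + c \<in> S} (\<lambda>z. f (z + c)) (\<lambda>z. f' (z + c))"
proof (intro C1_withI)
  fix z assume "z \<in> {z. z + c \<in> S}"
  then have "(f has_derivative f' (z + c)) (at (z + c))"
    using assms by (auto intro: C1_with_deriv)
  moreover have "((\<lambda>z. z + c) has_derivative (\<lambda>h. h)) (at z)"
    by (auto intro!: derivative_eq_intros)
  ultimately show "((\<lambda>z. f (z + c)) has_derivative f' (z + c)) (at z)"
    using has_derivative_compose by blast
next
  fix h
  show "continuous_on {z. z + c \<in> S} (\<lambda>z. f' (z + c) h)"
    using C1_with_cont_deriv[OF assms, of h]
    by (rule continuous_on_compose2) (auto intro!: continuous_intros)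
qed

lemma C1_with_line_deriv:
  assumes "C1_with S f f'" "z + s *\<^sub>R b \<in> S"
  shows "((\<lambda>s. f (z + s *\<^sub>R b)) has_real_derivative f' (z + s *\<^sub>R b) b) (at s)"
proof -
  have "((\<lambda>s. z + s *\<^sub>R b) has_derivative (\<lambda>h. h *\<^sub>R b)) (at s)"
    by (auto intro!: derivative_eq_intros)
  from has_derivative_compose[OF this C1_with_deriv[OF assms]]
  have "((\<lambda>s. f (z + s *\<^sub>R b)) has_derivative (\<lambda>h. f' (z + s *\<^sub>R b) (h *\<^sub>R b))) (at s)" .
  then show ?thesis
    unfolding has_field_derivative_def
    by (simp add: C1_with_linear[OF assms] mult.commute[of _ "f' (z + s *\<^sub>R b) b"])
qed

lemma C1_with_diff_quotient_bound:
  assumes C: "C1_with S f f'" and h: "h > 0"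
    and seg: "\<And>s. 0 \<le> s \<Longrightarrow> s \<le> h \<Longrightarrow> z + s *\<^sub>R b \<in> S"
    and M: "\<And>s. 0 \<le> s \<Longrightarrow> s \<le> h \<Longrightarrow> \<bar>f' (z + s *\<^sub>R b) b\<bar> \<le> M"
  shows "\<bar>(f (z + h *\<^sub>R b) - f z) / h\<bar> \<le> M"
proof -
  have "\<exists>s>0. s < h \<and> f (z + h *\<^sub>R b) - f (z + 0 *\<^sub>R b) = (h - 0) * f' (z + s *\<^sub>R b) b"
    by (rule MVT2[OF h]) (rule C1_with_line_deriv[OF C seg])
  then obtain s where "0 < s" "s < h" "f (z + h *\<^sub>R b) - f z = h * f' (z + s *\<^sub>R b) b"
    by auto
  then show ?thesis using M[of s] h by simp
qed

lemma C1_with_diff_quotient_tendsto: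
  assumes C: "C1_with S f f'" and z: "z \<in> S"
    and h: "h \<longlonglongrightarrow> 0" "\<And>n. h n \<noteq> (0::real)"
  shows "(\<lambda>n. (f (z + h n *\<^sub>R b) - f z) / h n) \<longlonglongrightarrow> f' z b"
proof -
  have "((\<lambda>s. (f (z + s *\<^sub>R b) - f z) / s) \<longlongrightarrow> f' z b) (at 0)"
    using C1_with_line_deriv[OF C, of z 0 b] z by (simp add: DERIV_def)
  then show ?thesis
    by (rule filterlim_compose) (use h in \<open>auto simp: filterlim_at\<close>)
qed

lemma C1_with_zero_off_deriv:
  assumes "C1_with UNIV f f'" "closed K" "\<And>z. z \<notin> K \<Longrightarrow> f z = 0" "z \<notin> K"
  shows "f' z h = 0"
proof -
  have "(f has_derivative f' z) (at z)"
    using assms by (auto intro: C1_with_deriv)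
  moreover have "(f has_derivative (\<lambda>_. 0)) (at z)"
    by (rule has_derivative_transform_within_open[of "\<lambda>_. 0" _ _ _ "- K"])
       (use assms in auto)
  ultimately have "f' z = (\<lambda>_. 0)" by (rule has_derivative_unique)
  then show ?thesis by simp
qed

text \<open>\<open>S\<close> and the complement of \<open>K\<close> are open and cover the space,
  and continuity is local.\<close>

lemma continuous_zero_extension:
  fixes g :: "'a::real_normed_vector \<Rightarrow> real"
  assumes "open S" "closed K" "K \<subseteq> S"
    and "continuous_on S g" "\<And>z. z \<notin> K \<Longrightarrow> g z = 0"
  shows "continuous_on UNIV g"
proof -
  have "continuous_on (- K) g"
    using assms(5) by (subst continuous_on_cong[of _ "- K" _ "\<lambda>_. 0"]) auto
  then have "continuous_on (S \<union> - K) g"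
    using assms by (intro continuous_on_open_Un) auto
  moreover have "S \<union> - K = UNIV" using assms by auto
  ultimately show ?thesis by simp
qed

lemma continuous_mult_test:
  fixes f g :: "'a::real_normed_vector \<Rightarrow> real"
  assumes "open S" "closed K" "K \<subseteq> S"
    and "continuous_on S f" "continuous_on S g" "\<And>z. z \<notin> K \<Longrightarrow> g z = 0"
  shows "continuous_on UNIV (\<lambda>z. f z * g z)"
  by (rule continuous_zero_extension[OF assms(1-3)]) (auto intro!: continuous_intros assms)

text \<open>A point outside \<open>S\<close> lies in the open complement of \<open>K\<close>, where
  the extension is identically zero; near a point of \<open>S\<close> the extension is
  \<open>g\<close>.\<close>

lemma C1_with_zero_extension:
  assumes S: "open S" "closed K" "K \<subseteq> S"
    and C: "C1_with S g g'" and 0: "\<And>z. z \<in> S - K \<Longrightarrow> g z = 0"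
  shows "C1_with UNIV (\<lambda>z. if z \<in> S then g z else 0) (\<lambda>z h. if z \<in> S then g' z h else 0)"
    (is "C1_with UNIV ?g ?g'")
proof (intro C1_withI)
  have g'0: "g' z h = 0" if z: "z \<in> S - K" for z h
  proof -
    have "(g has_derivative g' z) (at z)"
      using C z by (auto intro: C1_with_deriv)
    moreover have "(g has_derivative (\<lambda>_. 0)) (at z)"
      by (rule has_derivative_transform_within_open[of "\<lambda>_. 0" _ _ _ "S - K"])
         (use 0 z S in auto)
    ultimately have "g' z = (\<lambda>_. 0)" by (rule has_derivative_unique)
    then show ?thesis by simp
  qed
  show "(?g has_derivative ?g' z) (at z)" for z
  proof (cases "z \<in> S")
    case True
    then show ?thesis
      using C1_with_deriv[OF C True]
      by (auto intro: has_derivative_transform_within_open[of g _ _ _ S] simp: S)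
  next
    case False
    then have "((\<lambda>z. 0) has_derivative ?g' z) (at z)" by simp
    then show ?thesis
      by (rule has_derivative_transform_within_open[of _ _ _ _ "- K"]) (use 0 S False in auto)
  qed
  show "continuous_on UNIV (\<lambda>z. ?g' z h)" for h
  proof (rule continuous_zero_extension[OF S])
    show "continuous_on S (\<lambda>z. ?g' z h)"
      using C1_with_cont_deriv[OF C, of h] by (simp cong: continuous_on_cong)
  qed (auto simp: g'0)
qed

section \<open>Integrals and difference quotients of compactly supported functions\<close>

lemma integrable_continuous_compact_support:
  fixes g :: "'a::euclidean_space \<Rightarrow> real"
  assumes "continuous_on UNIV g" "compact K" "\<And>z. z \<notin> K \<Longrightarrow> g z = 0"
  shows "integrable lborel g"
proof -
  have "integrable lborel (\<lambda>x. indicator K x *\<^sub>R g x)"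
    using assms by (intro borel_integrable_compact) (auto intro: continuous_on_subset)
  also have "(\<lambda>x. indicator K x *\<^sub>R g x) = g"
    using assms by (auto simp: indicator_def fun_eq_iff)
  finally show ?thesis .
qed

lemma integral_translate:
  fixes g :: "'a::euclidean_space \<Rightarrow> real"
  assumes "g \<in> borel_measurable borel"
  shows "(LINT z|lborel. g (z + c)) = (LINT z|lborel. g z)"
proof -
  have "(LINT z|lborel. g z) = (LINT z|distr lborel borel ((+) c). g z)"
    by (simp add: lborel_distr_plus)
  also have "\<dots> = (LINT z|lborel. g (c + z))"
    using assms by (intro integral_distr) auto
  finally show ?thesis by (simp add: add.commute)
qed

lemma integrable_translate:
  fixes g :: "'a::euclidean_space \<Rightarrow> real"
  assumes "integrable lborel g"
  shows "integrable lborel (\<lambda>z. g (z + c))"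
proof -
  have m: "g \<in> borel_measurable borel" using assms by auto
  have "integrable (distr lborel borel ((+) c)) g"
    using assms by (simp add: lborel_distr_plus)
  then show ?thesis
    using m by (subst (asm) integrable_distr_eq) (auto simp: add.commute)
qed

text \<open>The fattening is the Minkowski sum of \<open>K\<close> and a closed ball. It serves as
  one compact carrier for all small translates of a function that vanishes off
  \<open>K\<close>.\<close>

lemma compact_fattening:
  fixes K :: "'a::euclidean_space set"
  assumes "compact K"
  shows "compact (\<Union>x\<in>K. cball x r)"
proof -
  have "(\<Union>x\<in>K. cball x r) = {x + y | x y. x \<in> K \<and> y \<in> cball 0 r}"
  proof (intro set_eqI iffI)
    fix z assume "z \<in> (\<Union>x\<in>K. cball x r)"
    then obtain x where "x \<in> K" "dist x z \<le> r" by auto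
    then have "z = x + (z - x) \<and> x \<in> K \<and> z - x \<in> cball 0 r"
      by (simp add: dist_norm norm_minus_commute)
    then show "z \<in> {x + y | x y. x \<in> K \<and> y \<in> cball 0 r}" by blast
  qed (force simp: dist_norm)
  then show ?thesis using compact_sums[OF assms compact_cball, of 0 r] by simp
qed

lemma bounded_on_compactE:
  fixes g :: "'a::topological_space \<Rightarrow> real"
  assumes "compact K" "continuous_on K g"
  obtains M where "M \<ge> 0" "\<And>z. z \<in> K \<Longrightarrow> \<bar>g z\<bar> \<le> M"
proof -
  have "bounded (g ` K)" using assms by (intro compact_imp_bounded compact_continuous_image)
  then obtain M where "\<And>x. x \<in> g ` K \<Longrightarrow> norm x \<le> M" unfolding bounded_iff by auto
  then show ?thesis
    by (intro that[of "max M 0"]) (force simp: le_max_iff_disj)+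
qed

text \<open>Supplies a dominating function for limits of difference quotients: the mean value
  theorem bounds them on the fattening, and outside it both \<open>z\<close> and the shifted point
  miss \<open>K\<close>.\<close>

lemma diff_quotient_test_bound:
  fixes g :: "'a::euclidean_space \<Rightarrow> real"
  assumes C: "C1_with UNIV g g'" and K: "compact K" "\<And>z. z \<notin> K \<Longrightarrow> g z = 0"
    and h: "0 < h" "h * norm b \<le> r" and M: "\<And>z. \<bar>g' z b\<bar> \<le> M"
  shows "\<bar>(g (z + h *\<^sub>R b) - g z) / h\<bar> \<le> M * indicator (\<Union>x\<in>K. cball x r) z"
proof (cases "z \<in> (\<Union>x\<in>K. cball x r)")
  case True
  then show ?thesis using C1_with_diff_quotient_bound[OF C h(1), of z b M] M by auto
next
  case False
  have "0 \<le> r" using h by (meson dual_order.trans less_imp_le mult_nonneg_nonneg norm_ge_zero)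
  with False have "z \<notin> K" "z + h *\<^sub>R b \<notin> K"
    using h by (auto simp: dist_norm)
  then show ?thesis using K False by simp
qed

lemma test_deriv_bounded:
  fixes g :: "'a::euclidean_space \<Rightarrow> real"
  assumes C: "C1_with UNIV g g'" and K: "compact K" "\<And>z. z \<notin> K \<Longrightarrow> g z = 0"
  obtains M where "M \<ge> 0" "\<And>z. \<bar>g' z b\<bar> \<le> M"
proof -
  obtain M where "M \<ge> 0" "\<And>z. z \<in> K \<Longrightarrow> \<bar>g' z b\<bar> \<le> M"
    using bounded_on_compactE[OF K(1) continuous_on_subset[OF C1_with_cont_deriv[OF C, of b]]]
    by auto
  then show ?thesis
    using C1_with_zero_off_deriv[OF C compact_imp_closed[OF K(1)] K(2)]
    by (intro that[of M]) (metis abs_zero)+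
qed

text \<open>Translation invariance makes the integral of every difference quotient zero; dominated
  convergence carries this over to the derivative.\<close>

lemma integral_test_deriv_eq_0:
  fixes g :: "'a::euclidean_space \<Rightarrow> real"
  assumes C: "C1_with UNIV g g'" and K: "compact K" "\<And>z. z \<notin> K \<Longrightarrow> g z = 0"
  shows "(LINT z|lborel. g' z b) = 0"
proof -
  obtain M where M: "M \<ge> 0" "\<And>z. \<bar>g' z b\<bar> \<le> M"
    using test_deriv_bounded[OF C K] by metis
  define h where "h n = 1 / real (Suc n)" for n
  have h: "h n > 0" "h n \<le> 1" for n by (auto simp: h_def field_simps)
  have h0: "h \<longlonglongrightarrow> 0" unfolding h_def by (rule LIMSEQ_Suc[OF lim_1_over_n])
  have int: "integrable lborel g"
    using C K by (intro integrable_continuous_compact_support C1_with_cont)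
  have meas: "g \<in> borel_measurable borel" using int by auto
  have "(\<lambda>n. LINT z|lborel. (g (z + h n *\<^sub>R b) - g z) / h n) \<longlonglongrightarrow> (LINT z|lborel. g' z b)"
  proof (rule integral_dominated_convergence)
    show "integrable lborel (\<lambda>z. M * indicator (\<Union>x\<in>K. cball x (norm b)) z)"
      using borel_integrable_compact[OF compact_fattening[OF K(1)], of "norm b" "\<lambda>_. 1::real"]
      by (intro integrable_mult_right) simp
    show "(\<lambda>z. g' z b) \<in> borel_measurable lborel"
      using C1_with_cont_deriv[OF C] by (simp add: borel_measurable_continuous_onI)
    show "AE z in lborel. norm ((g (z + h n *\<^sub>R b) - g z) / h n)
        \<le> M * indicator (\<Union>x\<in>K. cball x (norm b)) z" for n
      using diff_quotient_test_bound[OF C K h(1) _ M(2), of n "norm b"] h[of n]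
      by (simp add: mult_left_le_one_le)
    show "AE z in lborel. (\<lambda>n. (g (z + h n *\<^sub>R b) - g z) / h n) \<longlonglongrightarrow> g' z b"
      using C1_with_diff_quotient_tendsto[OF C _ h0] h(1)
      by (simp add: less_imp_neq[THEN not_sym])
  qed (use meas in measurable)
  moreover have "(\<lambda>n. LINT z|lborel. (g (z + h n *\<^sub>R b) - g z) / h n) = (\<lambda>_. 0)"
    using int integrable_translate[OF int] integral_translate[OF meas] by simp
  ultimately show ?thesis by (simp add: LIMSEQ_const_iff)
qed

section \<open>Integration by parts against test functions\<close>

lemma integrable_mult_test:
  fixes f g :: "'a::euclidean_space \<Rightarrow> real"
  assumes "open S" "compact K" "K \<subseteq> S"
    and "continuous_on S f" "continuous_on S g" "\<And>z. z \<notin> K \<Longrightarrow> g z = 0"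
  shows "integrable lborel (\<lambda>z. f z * g z)"
  by (rule integrable_continuous_compact_support
        [OF continuous_mult_test[OF assms(1) compact_imp_closed[OF assms(2)] assms(3-6)] assms(2)])
     (auto simp: assms(6))

lemma C1_with_bounded_linear:
  assumes "bounded_linear p"
  shows "C1_with S p (\<lambda>_. p)"
  by (intro C1_withI continuous_intros bounded_linear_imp_has_derivative assms)

text \<open>Integrals against \<psi> run over the whole space: \<psi> and its derivative vanish off
  \<open>K\<close>, so the other factor may be arbitrary outside \<open>S\<close>.\<close>

locale test_function =
  fixes S K :: "'a::euclidean_space set" and \<psi> :: "'a \<Rightarrow> real" and \<psi>' :: "'a \<Rightarrow> 'a \<Rightarrow> real"
  assumes S: "open S" and K: "compact K" and KS: "K \<subseteq> S"
    and C1: "C1_with UNIV \<psi> \<psi>'"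
    and zero: "\<And>z. z \<notin> K \<Longrightarrow> \<psi> z = 0"
begin

lemma deriv_zero: "z \<notin> K \<Longrightarrow> \<psi>' z h = 0"
  using C1_with_zero_off_deriv[OF C1 compact_imp_closed[OF K] zero] .

lemma cont: "continuous_on T \<psi>" and cont_deriv: "continuous_on T (\<lambda>z. \<psi>' z h)"
  using C1_with_cont[OF C1] C1_with_cont_deriv[OF C1] by (auto intro: continuous_on_subset)

lemma integrable:
  assumes "continuous_on S f"
  shows "integrable lborel (\<lambda>z. f z * \<psi> z)" "integrable lborel (\<lambda>z. f z * \<psi>' z h)"
  by (intro integrable_mult_test[OF S K KS] assms cont cont_deriv zero deriv_zero; assumption)+

text \<open>Extended by zero, the product of \<open>f\<close> and \<psi> is C^1 on the whole space
  with compact support, so its derivative integrates to zero.\<close>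

lemma integral_by_parts:
  assumes f: "C1_with S f f'"
  shows "(LINT z|lborel. f z * \<psi>' z b) = - (LINT z|lborel. f' z b * \<psi> z)"
proof -
  have "C1_with S (\<lambda>z. f z * \<psi> z) (\<lambda>z h. f z * \<psi>' z h + f' z h * \<psi> z)"
    by (intro C1_with_mult f C1_with_subset[OF C1]) auto
  then have "C1_with UNIV (\<lambda>z. if z \<in> S then f z * \<psi> z else 0)
      (\<lambda>z h. if z \<in> S then f z * \<psi>' z h + f' z h * \<psi> z else 0)"
    by (intro C1_with_zero_extension[of S K]) (auto simp: S K KS zero compact_imp_closed)
  then have "(LINT z|lborel. (if z \<in> S then f z * \<psi>' z b + f' z b * \<psi> z else 0)) = 0"
    by (rule integral_test_deriv_eq_0) (use K zero in auto)
  also have "(\<lambda>z. if z \<in> S then f z * \<psi>' z b + f' z b * \<psi> z else 0)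
      = (\<lambda>z. f z * \<psi>' z b + f' z b * \<psi> z)"
  proof
    fix z show "(if z \<in> S then f z * \<psi>' z b + f' z b * \<psi> z else 0) = f z * \<psi>' z b + f' z b * \<psi> z"
      using KS by (cases "z \<in> K") (auto simp: zero deriv_zero)
  qed
  finally show ?thesis
    using integrable[OF C1_with_cont[OF f]] integrable[OF C1_with_cont_deriv[OF f]] by simp
qed

text \<open>This absorbs the variable coefficient of a vector field into the test function, so that
  only constant directions remain.\<close>

lemma mult:
  assumes "C1_with UNIV q q'"
  shows "test_function S K (\<lambda>z. q z * \<psi> z) (\<lambda>z h. q z * \<psi>' z h + q' z h * \<psi> z)"
  by unfold_locales (use S K KS zero C1_with_mult[OF assms C1] in auto)

lemma shift_margin:
  obtains r where "r > 0" "(\<Union>x\<in>K. cball x r) \<subseteq> S"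
proof -
  obtain e where e: "e > 0" "(\<Union>x\<in>K. ball x e) \<subseteq> S"
    using compact_subset_open_imp_ball_epsilon_subset[OF K S KS] by metis
  then have "(\<Union>x\<in>K. cball x (e / 2)) \<subseteq> (\<Union>x\<in>K. ball x e)" by auto
  with e show thesis by (intro that[of "e / 2"]) auto
qed

text \<open>
  The difference quotient of \<open>f\<close> is moved onto \<open>\<psi>\<close> by translation invariance, so that \<open>f\<close>
  needs only one derivative.
\<close>

lemma integral_deriv_swap:
  assumes f: "C1_with S f f'"
  shows "(LINT z|lborel. f' z a * \<psi>' z b) = (LINT z|lborel. f' z b * \<psi>' z a)"
proof -
  obtain r where r: "r > 0" "(\<Union>x\<in>K. cball x r) \<subseteq> S" by (rule shift_margin)
  define Kr where "Kr = (\<Union>x\<in>K. cball x r)"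
  have Kr: "compact Kr" "Kr \<subseteq> S" "K \<subseteq> Kr"
    using r compact_fattening[OF K] by (auto simp: Kr_def)
  \<comment> \<open>Scaled so that every shift \<open>h n *\<^sub>R a\<close> has length at most
    \<open>r\<close> and moves \<open>K\<close> within \<open>Kr\<close>; the summand 1 covers
    \<open>a = 0\<close>.\<close>
  define c where "c = r / (1 + norm a)"
  have c: "c > 0" "c * norm a \<le> r"
    using r by (auto simp: c_def field_simps add_pos_nonneg)
  define h where "h n = c / real (Suc n)" for n
  have h0: "h \<longlonglongrightarrow> 0"
    unfolding h_def by (rule LIMSEQ_Suc[OF lim_const_over_n])
  have hpos: "h n > 0" for n
    using c by (simp add: h_def)
  have hr: "h n * norm a \<le> r" for n
  proof -
    have "h n \<le> c" using c by (simp add: h_def divide_le_eq)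
    then have "h n * norm a \<le> c * norm a" by (intro mult_right_mono) auto
    with c show ?thesis by simp
  qed
  have inKr: "z + s *\<^sub>R a \<in> Kr" if "z \<in> K" "0 \<le> s" "s \<le> h n" for z s n
  proof -
    have "s * norm a \<le> h n * norm a" using that by (intro mult_right_mono) auto
    with hr[of n] that show ?thesis by (auto simp: Kr_def dist_norm intro!: bexI[of _ z])
  qed
  have cf: "continuous_on S f" "\<And>h. continuous_on S (\<lambda>z. f' z h)"
    using C1_with_cont[OF f] C1_with_cont_deriv[OF f] by auto
  obtain M where M: "M \<ge> 0" "\<And>z. z \<in> Kr \<Longrightarrow> \<bar>f' z a\<bar> \<le> M"
    using bounded_on_compactE[OF Kr(1) continuous_on_subset[OF cf(2) Kr(2)]] by metis
  obtain N where N: "N \<ge> 0" "\<And>z. \<bar>\<psi>' z a\<bar> \<le> N"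
    using test_deriv_bounded[OF C1 K zero] by metis

  \<comment> \<open>\<open>F n\<close> has the difference quotient on \<open>f\<close>,
    \<open>G n\<close> has it on \<psi> with the opposite shift. Their integrals agree for each
    \<open>n\<close>, and the limits are the two sides of the claim.\<close>
  define F where "F n z = (f (z + h n *\<^sub>R a) - f z) / h n * \<psi>' z b" for n z
  define G where "G n z = f' z b * ((\<psi> (z + - h n *\<^sub>R a) - \<psi> z) / - h n)" for n z
  have step: "integrable lborel (F n) \<and> integrable lborel (G n) \<and>
      (LINT z|lborel. F n z) = (LINT z|lborel. G n z)" for n
  proof -
    define d where "d = h n *\<^sub>R a"
    \<comment> \<open>The translate of \<open>f\<close> is C^1 on the translated domain
      \<open>Sc\<close>, which still contains \<open>K\<close>. So \<psi> is a test function there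
      too, and both terms of the quotient can be integrated by parts.\<close>
    define Sc where "Sc = {z. z + d \<in> S}"
    have "Sc = (\<lambda>z. z + d) -` S" by (auto simp: Sc_def)
    then have "open Sc" using S by (auto intro!: open_vimage continuous_intros)
    moreover have "K \<subseteq> Sc"
      using inKr[of _ "h n" n] hpos[of n] Kr by (fastforce simp: Sc_def d_def)
    ultimately interpret shifted: test_function Sc K \<psi> \<psi>'
      using K C1 zero by unfold_locales auto
    note fc = C1_with_translate[OF f, of d, folded Sc_def]
    note [simp] = integrable[OF cf(1)] integrable[OF cf(2)]
      shifted.integrable[OF C1_with_cont[OF fc]] shifted.integrable[OF C1_with_cont_deriv[OF fc]]
    have int: "integrable lborel (\<lambda>z. f' z b * \<psi> (z + - d))"
      using integrable_translate[of "\<lambda>z. f' (z + d) b * \<psi> z" "- d"] by simp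
    have F: "F n = (\<lambda>z. (f (z + d) * \<psi>' z b - f z * \<psi>' z b) / h n)"
      by (auto simp: F_def d_def field_simps)
    have G: "G n = (\<lambda>z. (f' z b * \<psi> z - f' z b * \<psi> (z + - d)) / h n)"
      using hpos[of n] by (intro ext) (simp add: G_def d_def field_simps)
    have "(LINT z|lborel. f' (z + d) b * \<psi> z) = (LINT z|lborel. f' z b * \<psi> (z + - d))"
      using integral_translate[of "\<lambda>z. f' (z + d) b * \<psi> z" "- d"]
        borel_measurable_integrable[OF shifted.integrable(1)[OF C1_with_cont_deriv[OF fc]]] by simp
    with int show ?thesis
      unfolding F G using integral_by_parts[OF f] shifted.integral_by_parts[OF fc] by simp
  qed
  have "(\<lambda>n. LINT z|lborel. F n z) \<longlonglongrightarrow> (LINT z|lborel. f' z a * \<psi>' z b)"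
  proof (rule integral_dominated_convergence)
    show "integrable lborel (\<lambda>z. M * \<bar>1 * \<psi>' z b\<bar>)"
      by (intro integrable_mult_right integrable_abs integrable) auto
    show "(\<lambda>z. f' z a * \<psi>' z b) \<in> borel_measurable lborel"
      using integrable[OF cf(2)] by auto
    show "F n \<in> borel_measurable lborel" for n
      by (rule borel_measurable_integrable) (use step in blast)
    show "AE z in lborel. norm (F n z) \<le> M * \<bar>1 * \<psi>' z b\<bar>" for n
    proof (intro AE_I2)
      fix z
      show "norm (F n z) \<le> M * \<bar>1 * \<psi>' z b\<bar>"
      proof (cases "z \<in> K")
        case True
        have "\<bar>(f (z + h n *\<^sub>R a) - f z) / h n\<bar> \<le> M"
          by (rule C1_with_diff_quotient_bound[OF f hpos])
             (use True inKr[of z _ n] Kr M in auto)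
        then have "\<bar>(f (z + h n *\<^sub>R a) - f z) / h n\<bar> * \<bar>\<psi>' z b\<bar> \<le> M * \<bar>\<psi>' z b\<bar>"
          by (intro mult_right_mono) auto
        then show ?thesis unfolding F_def real_norm_def abs_mult by simp
      qed (simp add: F_def deriv_zero)
    qed
    show "AE z in lborel. (\<lambda>n. F n z) \<longlonglongrightarrow> f' z a * \<psi>' z b"
    proof (intro AE_I2)
      fix z
      show "(\<lambda>n. F n z) \<longlonglongrightarrow> f' z a * \<psi>' z b"
      proof (cases "z \<in> K")
        case True
        then show ?thesis unfolding F_def
          using KS hpos by (intro tendsto_mult C1_with_diff_quotient_tendsto[OF f _ h0])
            (auto simp: less_imp_neq[THEN not_sym])
      qed (simp add: F_def deriv_zero)
    qed
  qed
  moreover have "(\<lambda>n. LINT z|lborel. G n z) \<longlonglongrightarrow> (LINT z|lborel. f' z b * \<psi>' z a)"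
  proof (rule integral_dominated_convergence)
    show "integrable lborel (\<lambda>z. N * (indicator Kr z *\<^sub>R \<bar>f' z b\<bar>))"
      using cf(2) Kr
      by (intro integrable_mult_right borel_integrable_compact)
         (auto intro!: continuous_intros intro: continuous_on_subset)
    show "(\<lambda>z. f' z b * \<psi>' z a) \<in> borel_measurable lborel"
      using integrable[OF cf(2)] by auto
    show "G n \<in> borel_measurable lborel" for n
      by (rule borel_measurable_integrable) (use step in blast)
    show "AE z in lborel. norm (G n z) \<le> N * (indicator Kr z *\<^sub>R \<bar>f' z b\<bar>)" for n
    proof (intro AE_I2)
      fix z
      have "\<bar>(\<psi> (z + h n *\<^sub>R (- a)) - \<psi> z) / h n\<bar> \<le> N * indicator Kr z"
        unfolding Kr_def
        by (rule diff_quotient_test_bound[OF C1 K zero hpos])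
           (use hr N C1_with_linear(2)[OF C1, of z "-1" a for z] in auto)
      then have "\<bar>f' z b\<bar> * \<bar>(\<psi> (z + - h n *\<^sub>R a) - \<psi> z) / - h n\<bar> \<le> \<bar>f' z b\<bar> * (N * indicator Kr z)"
        by (intro mult_left_mono) (auto simp: abs_minus_commute)
      then show "norm (G n z) \<le> N * (indicator Kr z *\<^sub>R \<bar>f' z b\<bar>)"
        unfolding G_def real_norm_def abs_mult by (simp add: mult_ac)
    qed
    show "AE z in lborel. (\<lambda>n. G n z) \<longlonglongrightarrow> f' z b * \<psi>' z a"
    proof (intro AE_I2)
      fix z
      show "(\<lambda>n. G n z) \<longlonglongrightarrow> f' z b * \<psi>' z a"
        unfolding G_def using hpos tendsto_minus[OF h0]
        by (intro tendsto_mult C1_with_diff_quotient_tendsto[OF C1])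
           (auto simp: less_imp_neq[THEN not_sym])
    qed
  qed
  ultimately show ?thesis using step LIMSEQ_unique by auto
qed

text \<open>Such a field is divergence free: as \<open>p e = 0\<close>, the term
  \<open>p z * \<psi>' z e\<close> is the derivative along \<open>e\<close> of the product of
  \<open>p\<close> and \<psi>, again a test function.\<close>

lemma integral_deriv_field_eq_0:
  assumes p: "bounded_linear p" "p e = 0"
  shows "(LINT z|lborel. \<psi>' z (a + p z *\<^sub>R e)) = 0"
proof -
  have lin: "\<psi>' z (a + p z *\<^sub>R e) = \<psi>' z a + p z * \<psi>' z e" for z
    using C1_with_linear[OF C1] by simp
  interpret p: test_function S K "\<lambda>z. p z * \<psi> z" "\<lambda>z h. p z * \<psi>' z h + p h * \<psi> z"
    by (rule mult[OF C1_with_bounded_linear[OF p(1)]])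
  have "(LINT z|lborel. p z * \<psi>' z e) = 0"
    using integral_test_deriv_eq_0[OF p.C1 K p.zero, of e] p by simp
  then show ?thesis
    using integral_test_deriv_eq_0[OF C1 K zero, of a] integrable(2)[of "\<lambda>_. 1" a]
      integrable(2)[of p e] linear_continuous_on[OF p(1)]
    unfolding lin by simp
qed

text \<open>
  For \<open>V = a + p e\<close> and \<open>W = b + q e\<close> with \<open>p e = q e = 0\<close> the commutator \<open>[V, W]\<close> is
  \<open>(q a - p b) e\<close>.
\<close>

lemma integral_field_swap:
  assumes f: "C1_with S f f'"
    and p: "bounded_linear p" "p e = 0" and q: "bounded_linear q" "q e = 0"
  shows "(LINT z|lborel. f' z (a + p z *\<^sub>R e) * \<psi>' z (b + q z *\<^sub>R e)
            - f' z (b + q z *\<^sub>R e) * \<psi>' z (a + p z *\<^sub>R e))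
    = (q a - p b) * (LINT z|lborel. f' z e * \<psi> z)"
    and "integrable lborel (\<lambda>z. f' z (a + p z *\<^sub>R e) * \<psi>' z (b + q z *\<^sub>R e)
            - f' z (b + q z *\<^sub>R e) * \<psi>' z (a + p z *\<^sub>R e))"
proof -
  note cf = C1_with_cont_deriv[OF f]
  have pq: "continuous_on S p" "continuous_on S q"
    using p q by (auto intro: linear_continuous_on)
  \<comment> \<open>After expansion the terms with coefficient \<open>p z * q z\<close> cancel, and
    three antisymmetric pairs in constant directions remain.\<close>
  have lin: "f' z (a + p z *\<^sub>R e) * \<psi>' z (b + q z *\<^sub>R e) - f' z (b + q z *\<^sub>R e) * \<psi>' z (a + p z *\<^sub>R e)
      = (f' z a * \<psi>' z b - f' z b * \<psi>' z a)
      + ((q z * f' z a) * \<psi>' z e - (q z * f' z e) * \<psi>' z a)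
      + ((p z * f' z e) * \<psi>' z b - (p z * f' z b) * \<psi>' z e)" for z
  proof (cases "z \<in> K")
    case True
    then have "z \<in> S" using KS by auto
    then show ?thesis
      using C1_with_linear[OF C1, of z] C1_with_linear[OF f, of z] by (simp add: algebra_simps)
  qed (simp add: deriv_zero)
  have int: "integrable lborel (\<lambda>z. (q z * f' z h) * \<psi>' z h')"
    "integrable lborel (\<lambda>z. (p z * f' z h) * \<psi>' z h')"
    "integrable lborel (\<lambda>z. f' z h * \<psi>' z h')" "integrable lborel (\<lambda>z. f' z h * \<psi> z)" for h h'
    using cf pq by (auto intro!: integrable continuous_intros)
  interpret p: test_function S K "\<lambda>z. p z * \<psi> z" "\<lambda>z h. p z * \<psi>' z h + p h * \<psi> z"
    by (rule mult[OF C1_with_bounded_linear[OF p(1)]])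
  interpret q: test_function S K "\<lambda>z. q z * \<psi> z" "\<lambda>z h. q z * \<psi>' z h + q h * \<psi> z"
    by (rule mult[OF C1_with_bounded_linear[OF q(1)]])
  have P: "(\<lambda>z. f' z h * (p z * \<psi>' z h' + p h' * \<psi> z))
      = (\<lambda>z. (p z * f' z h) * \<psi>' z h' + p h' * (f' z h * \<psi> z))"
    and Q: "(\<lambda>z. f' z h * (q z * \<psi>' z h' + q h' * \<psi> z))
      = (\<lambda>z. (q z * f' z h) * \<psi>' z h' + q h' * (f' z h * \<psi> z))" for h h'
    by (auto simp: algebra_simps)
  \<comment> \<open>With the product of \<open>p\<close> and \<psi> as test function, the product
    rule adds a term with factor \<open>p b\<close> on one side, while its counterpart with
    \<open>p e\<close> vanishes. The same for \<open>q\<close> gives \<open>q a\<close>; together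
    they form the commutator.\<close>
  have "(LINT z|lborel. (p z * f' z e) * \<psi>' z b) + p b * (LINT z|lborel. f' z e * \<psi> z)
      = (LINT z|lborel. (p z * f' z b) * \<psi>' z e)"
    using p.integral_deriv_swap[OF f, of e b] int p(2) unfolding P by simp
  moreover have "(LINT z|lborel. (q z * f' z e) * \<psi>' z a) + q a * (LINT z|lborel. f' z e * \<psi> z)
      = (LINT z|lborel. (q z * f' z a) * \<psi>' z e)"
    using q.integral_deriv_swap[OF f, of e a] int q(2) unfolding Q by simp
  ultimately show "(LINT z|lborel. f' z (a + p z *\<^sub>R e) * \<psi>' z (b + q z *\<^sub>R e)
            - f' z (b + q z *\<^sub>R e) * \<psi>' z (a + p z *\<^sub>R e))
    = (q a - p b) * (LINT z|lborel. f' z e * \<psi> z)"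
    unfolding lin using int integral_deriv_swap[OF f, of a b] by (simp add: algebra_simps)
  show "integrable lborel (\<lambda>z. f' z (a + p z *\<^sub>R e) * \<psi>' z (b + q z *\<^sub>R e)
            - f' z (b + q z *\<^sub>R e) * \<psi>' z (a + p z *\<^sub>R e))"
    unfolding lin using int by simp
qed

end

section \<open>Operators in divergence form\<close>

lemma has_real_derivative_max_0_power2:
  "((\<lambda>x. (max 0 x)\<^sup>2) has_real_derivative 2 * max 0 x) (at (x::real))"
proof -
  consider "x > 0" | "x < 0" | "x = 0" by linarith
  then show ?thesis
  proof cases
    case 1
    have "((\<lambda>x. x\<^sup>2) has_real_derivative 2 * max 0 x) (at x)"
      using 1 by (auto intro!: derivative_eq_intros)
    then show ?thesis
      by (rule has_field_derivative_transform_within_open[of _ _ _ "{0<..}"]) (use 1 in auto)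
  next
    case 2
    have "((\<lambda>x. 0) has_real_derivative 2 * max 0 x) (at x)"
      using 2 by (auto intro!: derivative_eq_intros)
    then show ?thesis
      by (rule has_field_derivative_transform_within_open[of _ _ _ "{..<0}"]) (use 2 in auto)
  next
    case 3
    have "((\<lambda>h. (max 0 h)\<^sup>2 / h) \<longlongrightarrow> 0) (at (0::real))"
    proof (rule Lim_null_comparison)
      show "\<forall>\<^sub>F h in at 0. norm ((max 0 h)\<^sup>2 / h) \<le> \<bar>h\<bar>"
        by (intro always_eventually) (auto simp: max_def power2_eq_square)
      show "((\<lambda>h. \<bar>h\<bar>) \<longlongrightarrow> 0) (at (0::real))"
        by (rule tendsto_eq_intros refl)+ simp
    qed
    then show ?thesis using 3 by (simp add: DERIV_def)
  qed
qed

text \<open>A concrete choice of \<phi>. For positive \<open>k\<close> the shift by 1 makes it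
  vanish for \<open>s\<close> up to \<open>1 / k\<close>, the square smooths the corner of the
  positive part, and the quotient keeps the values below 1.\<close>

definition cutoff :: "real \<Rightarrow> real \<Rightarrow> real" where
  "cutoff k s = (max 0 (k * s - 1))\<^sup>2 / (1 + (max 0 (k * s - 1))\<^sup>2)"

definition cutoff_deriv :: "real \<Rightarrow> real \<Rightarrow> real" where
  "cutoff_deriv k s = 2 * k * max 0 (k * s - 1) / (1 + (max 0 (k * s - 1))\<^sup>2)\<^sup>2"

lemma has_real_derivative_cutoff:
  "(cutoff k has_real_derivative cutoff_deriv k s) (at s)"
proof -
  define m where "m = max 0 (k * s - 1)"
  have pos: "1 + m\<^sup>2 \<noteq> 0" by (smt (verit) zero_le_power2)
  have "((\<lambda>s. k * s - 1) has_real_derivative k) (at s)"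
    by (auto intro!: derivative_eq_intros)
  from DERIV_chain2[OF has_real_derivative_max_0_power2 this]
  have 1: "((\<lambda>s. (max 0 (k * s - 1))\<^sup>2) has_real_derivative 2 * m * k) (at s)"
    by (simp add: m_def)
  have "((\<lambda>s. (max 0 (k * s - 1))\<^sup>2 / (1 + (max 0 (k * s - 1))\<^sup>2)) has_real_derivative
      (2 * m * k * (1 + m\<^sup>2) - m\<^sup>2 * (0 + 2 * m * k)) / ((1 + m\<^sup>2) * (1 + m\<^sup>2))) (at s)"
    unfolding m_def by (rule DERIV_divide[OF 1[unfolded m_def] DERIV_add[OF DERIV_const 1[unfolded m_def]]])
       (use pos m_def in auto)
  also have "(2 * m * k * (1 + m\<^sup>2) - m\<^sup>2 * (0 + 2 * m * k)) / ((1 + m\<^sup>2) * (1 + m\<^sup>2)) = cutoff_deriv k s"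
    unfolding cutoff_deriv_def m_def[symmetric] by (simp add: power2_eq_square algebra_simps)
  finally show ?thesis unfolding cutoff_def[abs_def] .
qed

lemma continuous_on_cutoff_deriv: "continuous_on UNIV (cutoff_deriv k)"
proof -
  have "1 + (max 0 (k * s - 1))\<^sup>2 \<noteq> 0" for s :: real by (smt (verit) zero_le_power2)
  then show ?thesis unfolding cutoff_deriv_def[abs_def] by (intro continuous_intros) auto
qed

lemma cutoff_bounds: "0 \<le> cutoff k s" "cutoff k s \<le> 1"
  by (auto simp: cutoff_def divide_le_eq add_pos_nonneg)

lemma cutoff_deriv_nonneg: "k \<ge> 0 \<Longrightarrow> 0 \<le> cutoff_deriv k s"
  by (auto simp: cutoff_deriv_def)

lemma cutoff_eq_0: "k * s \<le> 1 \<Longrightarrow> cutoff k s = 0"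
  by (simp add: cutoff_def max_def)

lemma cutoff_tendsto_1:
  assumes "s > 0"
  shows "(\<lambda>n. cutoff (real (Suc n)) s) \<longlonglongrightarrow> 1"
proof -
  have "((\<lambda>m::real. m\<^sup>2 / (1 + m\<^sup>2)) \<longlongrightarrow> 1) at_top" by real_asymp
  moreover have "filterlim (\<lambda>x::real. max 0 (x * s - 1)) at_top at_top"
    using assms by real_asymp
  ultimately have "((\<lambda>k. cutoff k s) \<longlongrightarrow> 1) at_top"
    unfolding cutoff_def by (rule filterlim_compose)
  then show ?thesis
    by (rule filterlim_compose)
       (rule filterlim_compose[OF filterlim_real_sequentially filterlim_Suc])
qed

lemma C1_with_chain:
  assumes C: "C1_with S f f'"
    and \<phi>: "\<And>s. (\<phi> has_real_derivative \<phi>' s) (at s)" "continuous_on UNIV \<phi>'"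
  shows "C1_with S (\<lambda>z. \<phi> (f z)) (\<lambda>z h. \<phi>' (f z) * f' z h)"
proof (intro C1_withI)
  fix z assume "z \<in> S"
  from has_derivative_compose[OF C1_with_deriv[OF C this] \<phi>(1)[of "f z", unfolded has_field_derivative_def]]
  show "((\<lambda>z. \<phi> (f z)) has_derivative (\<lambda>h. \<phi>' (f z) * f' z h)) (at z)" .
next
  fix h
  have "continuous_on S (\<lambda>z. \<phi>' (f z))"
    by (rule continuous_on_compose2[OF \<phi>(2) C1_with_cont[OF C]]) auto
  then show "continuous_on S (\<lambda>z. \<phi>' (f z) * f' z h)"
    by (intro continuous_intros C1_with_cont_deriv[OF C])
qed

text \<open>The testing argument for an abstract coefficient matrix, so that it serves both
  inequalities; \<open>w2 j\<close> is the derivative of \<open>w\<close> differentiated along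
  \<open>V j\<close>. The boundary enters only through compactness of the superlevel sets of
  \<open>w\<close>.\<close>

lemma integral_divergence_form_nonpos:
  fixes A :: "'i::finite \<Rightarrow> 'i \<Rightarrow> 'a::euclidean_space \<Rightarrow> real"
    and a :: "'i \<Rightarrow> 'a" and p :: "'i \<Rightarrow> 'a \<Rightarrow> real" and e :: 'a
  defines "V \<equiv> \<lambda>i z. a i + p i z *\<^sub>R e"
  assumes \<Omega>: "open \<Omega>" "bounded \<Omega>"
    and p: "\<And>i. bounded_linear (p i)"
    and w: "C1_with \<Omega> w w'" "continuous_on (closure \<Omega>) w"
      "\<And>z. z \<in> frontier \<Omega> \<Longrightarrow> w z = 0" "\<And>z. z \<in> \<Omega> \<Longrightarrow> w z > 0"
    and Vw: "\<And>j. C1_with \<Omega> (\<lambda>z. w' z (V j z)) (w2 j)"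
    and A: "\<And>i j. continuous_on \<Omega> (A i j)"
    and A_nonneg: "\<And>z x. z \<in> \<Omega> \<Longrightarrow> 0 \<le> (\<Sum>j\<in>UNIV. \<Sum>i\<in>UNIV. A i j z * (x i * x j))"
    and A_div: "\<And>K \<psi> \<psi>' j. test_function \<Omega> K \<psi> \<psi>' \<Longrightarrow>
      (LINT z|lborel. (\<Sum>i\<in>UNIV. A i j z * \<psi>' z (V i z))) = 0"
    and int: "set_integrable lborel \<Omega> (\<lambda>z. \<Sum>j\<in>UNIV. \<Sum>i\<in>UNIV. A i j z * w2 j z (V i z))"
  shows "(LINT z:\<Omega>|lborel. \<Sum>j\<in>UNIV. \<Sum>i\<in>UNIV. A i j z * w2 j z (V i z)) \<le> 0"
proof -
  define L where "L z = (\<Sum>j\<in>UNIV. \<Sum>i\<in>UNIV. A i j z * w2 j z (V i z))" for z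
  define \<phi> where "\<phi> n = cutoff (real (Suc n))" for n
  define \<phi>' where "\<phi>' n = cutoff_deriv (real (Suc n))" for n
  have intL: "integrable lborel (\<lambda>z. indicator \<Omega> z *\<^sub>R L z)"
    using int by (simp add: set_integrable_def L_def)
  have \<phi>w: "C1_with \<Omega> (\<lambda>z. \<phi> n (w z)) (\<lambda>z h. \<phi>' n (w z) * w' z h)" for n
    unfolding \<phi>_def \<phi>'_def
    by (intro C1_with_chain[OF w(1)] has_real_derivative_cutoff continuous_on_cutoff_deriv)
  have int_n: "integrable lborel (\<lambda>z. \<phi> n (w z) * (indicator \<Omega> z *\<^sub>R L z))" for n
  proof (rule Bochner_Integration.integrable_bound[OF intL])
    \<comment> \<open>\<open>\<phi> n (w z)\<close> is continuous on \<Omega> but arbitrary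
      elsewhere, so measurability is first shown with an indicator, which the second factor
      absorbs.\<close>
    have "(\<lambda>z. indicator \<Omega> z *\<^sub>R \<phi> n (w z)) \<in> borel_measurable lborel"
      using borel_measurable_continuous_on_indicator[OF _ C1_with_cont[OF \<phi>w]] \<Omega> by simp
    from borel_measurable_times[OF this borel_measurable_integrable[OF intL]]
    show "(\<lambda>z. \<phi> n (w z) * (indicator \<Omega> z *\<^sub>R L z)) \<in> borel_measurable lborel"
      by (rule measurable_cong[THEN iffD1, rotated]) (auto simp: indicator_def)
    show "AE z in lborel. norm (\<phi> n (w z) * (indicator \<Omega> z *\<^sub>R L z)) \<le> norm (indicator \<Omega> z *\<^sub>R L z)"
      using cutoff_bounds by (auto simp: \<phi>_def abs_mult intro!: AE_I2 mult_left_le_one_le)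
  qed
  have le: "(LINT z|lborel. \<phi> n (w z) * (indicator \<Omega> z *\<^sub>R L z)) \<le> 0" for n
  proof -
    \<comment> \<open>The cutoff of \<open>w\<close> vanishes on \<Omega> outside this superlevel
      set, which is compact and avoids the frontier because \<open>w\<close> is zero there.\<close>
    define K where "K = {z \<in> closure \<Omega>. 1 / real (Suc n) \<le> w z}"
    have "K = closure \<Omega> \<inter> w -` {1 / real (Suc n)..}" by (auto simp: K_def)
    then have "closed K"
      using continuous_closed_preimage[OF w(2) closed_closure closed_atLeast] by simp
    moreover have "K \<subseteq> closure \<Omega>" by (auto simp: K_def)
    ultimately have K: "compact K"
      using \<Omega>(2) by (metis bounded_closure bounded_subset compact_eq_bounded_closed)
    have KS: "K \<subseteq> \<Omega>"
    proof
      fix z assume z: "z \<in> K"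
      then have "w z > 0" by (auto simp: K_def intro: less_le_trans[of 0 "1 / real (Suc n)"])
      then have "z \<notin> frontier \<Omega>" using w(3) by force
      then show "z \<in> \<Omega>" using z by (auto simp: K_def closure_Un_frontier)
    qed
    define \<psi> where "\<psi> j z = (if z \<in> \<Omega> then \<phi> n (w z) * w' z (V j z) else 0)" for j z
    define \<psi>' where "\<psi>' j z h = (if z \<in> \<Omega> then \<phi> n (w z) * w2 j z h
        + \<phi>' n (w z) * w' z h * w' z (V j z) else 0)" for j z h
    have test: "test_function \<Omega> K (\<psi> j) (\<psi>' j)" for j
    proof
      have 0: "\<phi> n (w z) = 0" if "z \<in> \<Omega> - K" for z
      proof -
        have "w z < 1 / real (Suc n)" using that closure_subset by (fastforce simp: K_def)
        then show ?thesis unfolding \<phi>_def by (intro cutoff_eq_0) (simp add: field_simps)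
      qed
      show "\<psi> j z = 0" if "z \<notin> K" for z using 0 that by (auto simp: \<psi>_def)
      show "C1_with UNIV (\<psi> j) (\<psi>' j)"
        unfolding \<psi>_def[abs_def] \<psi>'_def[abs_def]
        by (rule C1_with_zero_extension[OF \<Omega>(1) compact_imp_closed[OF K] KS
              C1_with_mult[OF \<phi>w Vw]]) (use 0 in auto)
    qed (use \<Omega> K KS in auto)
    have cV: "continuous_on \<Omega> (\<lambda>z. \<psi>' j z (V i z))" for i j
    proof -
      interpret test_function \<Omega> K "\<psi> j" "\<psi>' j" by (rule test)
      have "continuous_on \<Omega> (\<lambda>z. \<psi>' j z (a i) + p i z * \<psi>' j z e)"
        using linear_continuous_on[OF p] cont_deriv by (intro continuous_intros)
      then show ?thesis
        using C1_with_linear[OF C1] by (simp add: V_def)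
    qed
    have int_A: "integrable lborel (\<lambda>z. A i j z * \<psi>' j z (V i z))" for i j
      by (rule integrable_mult_test[OF \<Omega>(1) K KS A cV])
         (rule test_function.deriv_zero[OF test])
    \<comment> \<open>The product rule yields the integrand wanted plus the quadratic form of
      \<open>A\<close> at the derivatives of \<open>w\<close> along the fields, weighted by
      \<open>\<phi>' n (w z)\<close>. The second part is nonnegative, so the first is bounded by the
      whole sum, whose integral is zero.\<close>
    have eq: "(\<Sum>j\<in>UNIV. \<Sum>i\<in>UNIV. A i j z * \<psi>' j z (V i z))
        = \<phi> n (w z) * (indicator \<Omega> z *\<^sub>R L z) + indicator \<Omega> z * (\<phi>' n (w z) *
          (\<Sum>j\<in>UNIV. \<Sum>i\<in>UNIV. A i j z * (w' z (V i z) * w' z (V j z))))" for z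
      by (cases "z \<in> \<Omega>")
         (simp_all add: \<psi>'_def L_def sum_distrib_left sum.distrib algebra_simps)
    have "(LINT z|lborel. \<phi> n (w z) * (indicator \<Omega> z *\<^sub>R L z))
        \<le> (LINT z|lborel. (\<Sum>j\<in>UNIV. \<Sum>i\<in>UNIV. A i j z * \<psi>' j z (V i z)))"
    proof (rule integral_mono[OF int_n])
      show "integrable lborel (\<lambda>z. \<Sum>j\<in>UNIV. \<Sum>i\<in>UNIV. A i j z * \<psi>' j z (V i z))"
        using int_A by (intro Bochner_Integration.integrable_sum)
      show "\<phi> n (w z) * (indicator \<Omega> z *\<^sub>R L z)
          \<le> (\<Sum>j\<in>UNIV. \<Sum>i\<in>UNIV. A i j z * \<psi>' j z (V i z))" for z
        unfolding eq using A_nonneg[of z "\<lambda>i. w' z (V i z)"]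
        by (cases "z \<in> \<Omega>") (auto simp: \<phi>'_def intro!: mult_nonneg_nonneg cutoff_deriv_nonneg)
    qed
    also have "\<dots> = (\<Sum>j\<in>UNIV. LINT z|lborel. (\<Sum>i\<in>UNIV. A i j z * \<psi>' j z (V i z)))"
      using int_A by (intro Bochner_Integration.integral_sum Bochner_Integration.integrable_sum)
    also have "\<dots> = 0" using A_div[OF test] by simp
    finally show ?thesis .
  qed
  \<comment> \<open>Since \<open>w\<close> is positive in \<Omega>, the cutoffs tend to 1 pointwise;
    the absolute value of \<open>L\<close> on \<Omega> dominates.\<close>
  have "(\<lambda>n. LINT z|lborel. \<phi> n (w z) * (indicator \<Omega> z *\<^sub>R L z))
      \<longlonglongrightarrow> (LINT z|lborel. indicator \<Omega> z *\<^sub>R L z)"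
  proof (rule integral_dominated_convergence)
    show "integrable lborel (\<lambda>z. norm (indicator \<Omega> z *\<^sub>R L z))" using intL by (rule integrable_norm)
    show "AE z in lborel. norm (\<phi> n (w z) * (indicator \<Omega> z *\<^sub>R L z)) \<le> norm (indicator \<Omega> z *\<^sub>R L z)" for n
      using cutoff_bounds by (auto simp: \<phi>_def abs_mult intro!: AE_I2 mult_left_le_one_le)
    show "AE z in lborel. (\<lambda>n. \<phi> n (w z) * (indicator \<Omega> z *\<^sub>R L z)) \<longlonglongrightarrow> indicator \<Omega> z *\<^sub>R L z"
    proof (intro AE_I2)
      fix z
      show "(\<lambda>n. \<phi> n (w z) * (indicator \<Omega> z *\<^sub>R L z)) \<longlonglongrightarrow> indicator \<Omega> z *\<^sub>R L z"
      proof (cases "z \<in> \<Omega>")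
        case True
        have "(\<lambda>n. \<phi> n (w z) * L z) \<longlonglongrightarrow> 1 * L z"
          unfolding \<phi>_def by (intro tendsto_intros cutoff_tendsto_1 w(4) True)
        with True show ?thesis by simp
      qed simp
    qed
  qed (use intL int_n in auto)
  then have "(LINT z|lborel. indicator \<Omega> z *\<^sub>R L z) \<le> 0"
    using le by (intro LIMSEQ_le_const2) auto
  then show ?thesis by (simp add: set_lebesgue_integral_def L_def)
qed

section \<open>Twice continuously differentiable functions\<close>

lemma C1_with_cong:
  assumes C: "C1_with S f f'" and S: "open S" and eq: "\<And>z. z \<in> S \<Longrightarrow> g z = f z"
  shows "C1_with S g f'"
proof (intro C1_withI C1_with_cont_deriv[OF C])
  fix z assume z: "z \<in> S"
  show "(g has_derivative f' z) (at z)"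
    by (rule has_derivative_transform_within_open[OF C1_with_deriv[OF C z] S z]) (simp add: eq)
qed

text \<open>The body of \<open>C2_on\<close> with its witnesses exposed, so that sums and
  differences come with explicit derivatives.\<close>

definition C2_with ::
    "'a::real_normed_vector set \<Rightarrow> ('a \<Rightarrow> real) \<Rightarrow> ('a \<Rightarrow> 'a \<Rightarrow>\<^sub>L real) \<Rightarrow>
      ('a \<Rightarrow> 'a \<Rightarrow>\<^sub>L 'a \<Rightarrow>\<^sub>L real) \<Rightarrow> bool" where
  "C2_with S u u' u'' \<longleftrightarrow>
    (\<forall>z\<in>S. (u has_derivative blinfun_apply (u' z)) (at z)) \<and>
    (\<forall>z\<in>S. (u' has_derivative blinfun_apply (u'' z)) (at z)) \<and>
    continuous_on S u''"

lemma C2_with_add: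
  assumes "C2_with S u u' u''" "C2_with S v v' v''"
  shows "C2_with S (\<lambda>z. u z + v z) (\<lambda>z. u' z + v' z) (\<lambda>z. u'' z + v'' z)"
  using assms
  by (auto simp: C2_with_def plus_blinfun.rep_eq[abs_def]
      intro!: continuous_intros derivative_eq_intros)

lemma C2_with_diff:
  assumes "C2_with S u u' u''" "C2_with S v v' v''"
  shows "C2_with S (\<lambda>z. u z - v z) (\<lambda>z. u' z - v' z) (\<lambda>z. u'' z - v'' z)"
  using assms
  by (auto simp: C2_with_def minus_blinfun.rep_eq[abs_def]
      intro!: continuous_intros derivative_eq_intros)

lemma C2_with_imp_C1_with:
  assumes "C2_with S u u' u''"
  shows "C1_with S u (\<lambda>z h. u' z h)"
    and "C1_with S (\<lambda>z. u' z k) (\<lambda>z h. u'' z h k)"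
proof -
  have d: "(u has_derivative blinfun_apply (u' z)) (at z)"
    "(u' has_derivative blinfun_apply (u'' z)) (at z)" if "z \<in> S" for z
    using that assms by (auto simp: C2_with_def)
  have c: "continuous_on S u''" using assms by (auto simp: C2_with_def)
  have "continuous_on S u'"
    by (rule has_derivative_continuous_on) (rule has_derivative_at_withinI[OF d(2)])
  then show "C1_with S u (\<lambda>z h. u' z h)"
    by (intro C1_withI d continuous_intros)
  show "C1_with S (\<lambda>z. u' z k) (\<lambda>z h. u'' z h k)"
    by (intro C1_withI bounded_linear.has_derivative[OF blinfun.bounded_linear_left d(2)]
        continuous_intros c)
qed

text \<open>Schwarz's theorem: both orders of differentiation give the same second difference of \<open>u\<close>.\<close>

lemma second_difference_MVT:
  assumes C: "C2_with S u u' u''" and ball: "ball z r \<subseteq> S"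
    and h: "h > 0" "h * (norm a + norm b) < r"
  obtains p where "dist z p < r"
    "u (z + h *\<^sub>R a + h *\<^sub>R b) - u (z + h *\<^sub>R a) - u (z + h *\<^sub>R b) + u z = h * h * u'' p b a"
proof -
  have near: "dist z (z + s *\<^sub>R a + t *\<^sub>R b) < r" if "0 \<le> s" "s \<le> h" "0 \<le> t" "t \<le> h" for s t
  proof -
    have "norm (s *\<^sub>R a + t *\<^sub>R b) \<le> s * norm a + t * norm b"
      using that norm_triangle_ineq[of "s *\<^sub>R a" "t *\<^sub>R b"] by simp
    also have "\<dots> \<le> h * norm a + h * norm b"
      using that by (intro add_mono mult_right_mono) auto
    finally have "norm (s *\<^sub>R a + t *\<^sub>R b) < r" using h by (simp add: distrib_left)
    moreover have "dist z (z + v) = norm v" for v by (simp add: dist_norm)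
    ultimately show ?thesis by (simp add: add.assoc)
  qed
  have inS: "z + s *\<^sub>R a + t *\<^sub>R b \<in> S" if "0 \<le> s" "s \<le> h" "0 \<le> t" "t \<le> h" for s t
    using near[OF that] ball by auto
  note C1 = C2_with_imp_C1_with[OF C]
  \<comment> \<open>The difference in direction \<open>b\<close> is kept whole while the mean value
    theorem acts in direction \<open>a\<close>; a second application then acts in direction
    \<open>b\<close>.\<close>
  define g where "g s = u (z + s *\<^sub>R a + h *\<^sub>R b) - u (z + s *\<^sub>R a)" for s
  have "\<exists>s>0. s < h \<and> g h - g 0
      = (h - 0) * (u' (z + s *\<^sub>R a + h *\<^sub>R b) a - u' (z + s *\<^sub>R a) a)"
  proof (rule MVT2[OF h(1)])
    fix s assume s: "0 \<le> s" "s \<le> h"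
    have 1: "(z + h *\<^sub>R b) + s *\<^sub>R a \<in> S" "z + s *\<^sub>R a \<in> S"
      using inS[of s h] inS[of s 0] s h by (auto simp: add_ac)
    show "(g has_real_derivative (u' (z + s *\<^sub>R a + h *\<^sub>R b) a - u' (z + s *\<^sub>R a) a)) (at s)"
      using DERIV_diff[OF C1_with_line_deriv[OF C1(1) 1(1)] C1_with_line_deriv[OF C1(1) 1(2)]]
      unfolding g_def[abs_def] by (simp add: add_ac)
  qed
  then obtain s where s: "0 < s" "s < h"
    "g h - g 0 = h * (u' (z + s *\<^sub>R a + h *\<^sub>R b) a - u' (z + s *\<^sub>R a) a)" by auto
  have "\<exists>t>0. t < h \<and> u' (z + s *\<^sub>R a + h *\<^sub>R b) a - u' (z + s *\<^sub>R a + 0 *\<^sub>R b) a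
      = (h - 0) * u'' (z + s *\<^sub>R a + t *\<^sub>R b) b a"
    by (rule MVT2[OF h(1)]) (rule C1_with_line_deriv[OF C1(2)], use s inS in auto)
  then obtain t where t: "0 < t" "t < h"
    "u' (z + s *\<^sub>R a + h *\<^sub>R b) a - u' (z + s *\<^sub>R a) a = h * u'' (z + s *\<^sub>R a + t *\<^sub>R b) b a"
    by auto
  show thesis
    by (rule that[of "z + s *\<^sub>R a + t *\<^sub>R b"])
       (use s t near[of s t] in \<open>simp_all add: g_def algebra_simps\<close>)
qed

lemma C2_with_symmetric:
  assumes C: "C2_with S u u' u''" and S: "open S" and z: "z \<in> S"
  shows "u'' z a b = u'' z b a"
proof (rule ccontr)
  assume neq: "u'' z a b \<noteq> u'' z b a"
  \<comment> \<open>Half the gap: numbers strictly within \<epsilon> of the two values cannot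
    coincide.\<close>
  define \<epsilon> where "\<epsilon> = \<bar>u'' z a b - u'' z b a\<bar> / 2"
  have \<epsilon>: "\<epsilon> > 0" using neq by (simp add: \<epsilon>_def)
  have "\<forall>\<^sub>F p in nhds z. dist (u'' p a b) (u'' z a b) < \<epsilon>" for a b
  proof -
    have "isCont (\<lambda>p. u'' p a b) z"
      using C1_with_cont_deriv[OF C2_with_imp_C1_with(2)[OF C]] S z
      by (simp add: continuous_on_eq_continuous_at)
    then show ?thesis
      using tendstoD[OF _ \<epsilon>] by (simp add: isCont_def tendsto_at_iff_tendsto_nhds[of "\<lambda>p. u'' p a b"])
  qed
  from eventually_conj[OF this[of a b] this[of b a]]
  have "\<forall>\<^sub>F p in nhds z. p \<in> S \<and> dist (u'' p a b) (u'' z a b) < \<epsilon> \<and> dist (u'' p b a) (u'' z b a) < \<epsilon>"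
    using eventually_nhds_in_open[OF S z] by (auto elim: eventually_elim2)
  then obtain r where r: "r > 0" "\<And>p. dist p z < r \<Longrightarrow>
      p \<in> S \<and> dist (u'' p a b) (u'' z a b) < \<epsilon> \<and> dist (u'' p b a) (u'' z b a) < \<epsilon>"
    unfolding eventually_nhds_metric by blast
  have ball: "ball z r \<subseteq> S" using r(2) by (auto simp: dist_commute)
  \<comment> \<open>Exceeds \<open>norm a + norm b\<close> and is positive even if both vectors
    vanish, so that \<open>r / c\<close> is a step fitting into the ball.\<close>
  define c where "c = 1 + norm a + norm b"
  have c: "c > 0" "norm a + norm b < c" by (auto simp: c_def add_pos_nonneg)
  define h where "h = r / c"
  have h: "h > 0" using r c by (simp add: h_def)
  have hr: "h * (norm a + norm b) < r"
    using mult_strict_left_mono[OF c(2) h] c by (simp add: h_def)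
  then have hr': "h * (norm b + norm a) < r" by (simp add: add.commute)
  obtain p where p: "dist z p < r"
    "u (z + h *\<^sub>R a + h *\<^sub>R b) - u (z + h *\<^sub>R a) - u (z + h *\<^sub>R b) + u z = h * h * u'' p b a"
    using second_difference_MVT[OF C ball h hr] .
  obtain q where q: "dist z q < r"
    "u (z + h *\<^sub>R b + h *\<^sub>R a) - u (z + h *\<^sub>R b) - u (z + h *\<^sub>R a) + u z = h * h * u'' q a b"
    using second_difference_MVT[OF C ball h hr'] .
  have "z + h *\<^sub>R b + h *\<^sub>R a = z + h *\<^sub>R a + h *\<^sub>R b" by simp
  then have "u (z + h *\<^sub>R b + h *\<^sub>R a) = u (z + h *\<^sub>R a + h *\<^sub>R b)" by (rule arg_cong)
  then have "h * h * u'' p b a = h * h * u'' q a b"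
    using p(2) q(2) by linarith
  then have "u'' p b a = u'' q a b" using h by simp
  moreover have "dist (u'' q a b) (u'' z a b) < \<epsilon>" "dist (u'' p b a) (u'' z b a) < \<epsilon>"
    using r(2) p(1) q(1) by (auto simp: dist_commute)
  ultimately show False by (simp add: \<epsilon>_def dist_real_def abs_if split: if_splits)
qed

section \<open>The Heisenberg Hessian\<close>

lemma C1_with_partial_deriv:
  assumes "C1_with S f f'" "z \<in> S"
  shows "partial_deriv e f z = f' z e"
  using DERIV_imp_deriv[OF C1_with_line_deriv[OF assms(1), of z 0 e]] assms(2)
  by (simp add: partial_deriv_def)

text \<open>
  The field \<open>X\<^sub>i\<close> is \<open>z \<mapsto> base i + slope i z \<partial>\<^sub>t\<close>, and \<open>[X\<^sub>i, X\<^sub>j] = 2 \<cdot> slope j (base i) \<partial>\<^sub>t\<close>.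
\<close>

definition vert :: "'n::finite heis" where
  "vert = (0, 0, 1)"

fun base :: "'n::finite + 'n \<Rightarrow> 'n heis" where
  "base (Inl j) = (axis j 1, 0, 0)"
| "base (Inr j) = (0, axis j 1, 0)"

fun slope :: "'n::finite + 'n \<Rightarrow> 'n heis \<Rightarrow> real" where
  "slope (Inl j) z = 2 * fst (snd z) $ j"
| "slope (Inr j) z = - 2 * fst z $ j"

definition heis_vec :: "'n::finite + 'n \<Rightarrow> 'n heis \<Rightarrow> 'n heis" where
  "heis_vec i z = base i + slope i z *\<^sub>R vert"

lemma bounded_linear_slope: "bounded_linear (slope i)"
proof (cases i)
  case (Inl j)
  have "bounded_linear (\<lambda>z::'a heis. 2 * fst (snd z) $ j)"
    by (intro bounded_linear_const_mult bounded_linear_vec_nth[THEN bounded_linear_compose]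
        bounded_linear_fst_comp bounded_linear_snd)
  also have "(\<lambda>z::'a heis. 2 * fst (snd z) $ j) = slope i" using Inl by (simp add: fun_eq_iff)
  finally show ?thesis .
next
  case (Inr j)
  have "bounded_linear (\<lambda>z::'a heis. - 2 * fst z $ j)"
    by (intro bounded_linear_const_mult bounded_linear_vec_nth[THEN bounded_linear_compose]
        bounded_linear_fst)
  also have "(\<lambda>z::'a heis. - 2 * fst z $ j) = slope i" using Inr by (simp add: fun_eq_iff)
  finally show ?thesis .
qed

lemma slope_vert [simp]: "slope i vert = 0"
  by (cases i) (auto simp: vert_def)

lemma slope_add: "slope i (x + y) = slope i x + slope i y"
  and slope_scaleR: "slope i (c *\<^sub>R x) = c * slope i x"
  by (cases i; simp add: algebra_simps)+

lemma slope_heis_vec [simp]: "slope i (heis_vec j z) = slope i (base j)"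
  by (simp add: heis_vec_def slope_add slope_scaleR)

text \<open>Up to sign these numbers are the entries of twice the standard symplectic form.\<close>

lemma slope_base_antisym: "slope j (base i) = - slope i (base j)"
  by (cases i; cases j) (auto simp: axis_def)

lemma sum_UNIV_sum:
  "(\<Sum>i\<in>(UNIV :: ('a::finite + 'b::finite) set). f i) = (\<Sum>i\<in>UNIV. f (Inl i)) + (\<Sum>i\<in>UNIV. f (Inr i))"
  using sum.Plus[of UNIV UNIV f] by simp

text \<open>There are 2n nonzero entries, each 2 or -2. Multiplied by 3/2 in the polarization
  identity, 8n becomes the constant 12n of the theorem.\<close>

lemma sum_slope_base_power2:
  "(\<Sum>j\<in>UNIV. \<Sum>i\<in>UNIV. (slope j (base i :: 'n::finite heis))\<^sup>2) = 8 * real CARD('n)"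
proof -
  have "(2 * axis i (1::real) $ j)\<^sup>2 = (if i = j then 4 else 0)" for i j :: 'n
    by (simp add: axis_def)
  then show ?thesis
    by (simp add: sum_UNIV_sum sum.distrib)
qed

lemma C1_with_heis_field:
  assumes "C1_with S f f'" "z \<in> S"
  shows "heis_field i f z = f' z (heis_vec i z)"
proof (cases i)
  case (Inl j)
  then show ?thesis
    using C1_with_linear[OF assms] C1_with_partial_deriv[OF assms]
    by (cases z) (simp add: heis_vec_def dx_def dt_def vert_def[symmetric])
next
  case (Inr j)
  then show ?thesis
    using C1_with_linear[OF assms] C1_with_partial_deriv[OF assms]
      C1_with_linear(2)[OF assms, of "-1" "(2 * fst z $ j) *\<^sub>R vert"]
    by (cases z) (simp add: heis_vec_def dy_def dt_def vert_def[symmetric])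
qed

text \<open>The last term comes from differentiating the coefficient \<open>slope j\<close> of the
  field.\<close>

lemma C2_with_field:
  assumes C: "C2_with S u u' u''"
  shows "C1_with S (\<lambda>z. u' z (heis_vec j z)) (\<lambda>z h. u'' z h (heis_vec j z) + slope j h * u' z vert)"
proof -
  note C1 = C2_with_imp_C1_with(2)[OF C]
  have eq: "u' z (heis_vec j z) = u' z (base j) + slope j z * u' z vert"
    "u'' z h (heis_vec j z) = u'' z h (base j) + slope j z * u'' z h vert" for z h
    by (auto simp: heis_vec_def blinfun.bilinear_simps)
  note m = C1_with_mult[OF C1_with_bounded_linear[OF bounded_linear_slope] C1, of j vert]
  show ?thesis
    unfolding eq
  proof (intro C1_withI)
    fix z assume z: "z \<in> S"
    show "((\<lambda>z. u' z (base j) + slope j z * u' z vert) has_derivative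
        (\<lambda>h. u'' z h (base j) + slope j z * u'' z h vert + slope j h * u' z vert)) (at z)"
      using has_derivative_add[OF C1_with_deriv[OF C1 z] C1_with_deriv[OF m z]]
      by (simp add: add.assoc)
  next
    fix h
    show "continuous_on S (\<lambda>z. u'' z h (base j) + slope j z * u'' z h vert + slope j h * u' z vert)"
      using continuous_on_add[OF C1_with_cont_deriv[OF C1] C1_with_cont_deriv[OF m]]
      by (simp add: add.assoc)
  qed
qed

lemma C2_with_dt:
  assumes C: "C2_with S u u' u''" and z: "z \<in> S"
  shows "dt u z = u' z vert"
  unfolding dt_def vert_def by (rule C1_with_partial_deriv[OF C2_with_imp_C1_with(1)[OF C] z])

text \<open>The first-order terms of the two orders of differentiation are opposite, so
  symmetrization leaves only the second derivative evaluated on the fields.\<close>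

lemma C2_with_heis_hessian:
  assumes C: "C2_with S u u' u''" and S: "open S" and z: "z \<in> S"
  shows "heis_hessian u z $ i $ j = u'' z (heis_vec i z) (heis_vec j z)"
proof -
  have "C1_with S (heis_field j u) (\<lambda>z h. u'' z h (heis_vec j z) + slope j h * u' z vert)" for j
    by (rule C1_with_cong[OF C2_with_field[OF C] S])
       (rule C1_with_heis_field[OF C2_with_imp_C1_with(1)[OF C]])
  from C1_with_heis_field[OF this z]
  have "heis_field i (heis_field j u) z
      = u'' z (heis_vec i z) (heis_vec j z) + slope j (base i) * u' z vert" for i j
    by simp
  then show ?thesis
    using slope_base_antisym[of i j] C2_with_symmetric[OF C S z]
    by (simp add: heis_hessian_def)
qed

section \<open>Algebra of the second symmetric function\<close>

lemma index_less_cases: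
  fixes i j :: "'n::linorder + 'n"
  shows "i = j \<or> index_less i j \<or> index_less j i"
  by (cases i; cases j) auto

lemma index_less_asym:
  fixes i j :: "'n::linorder + 'n"
  shows "index_less i j \<Longrightarrow> \<not> index_less j i"
  by (cases i; cases j) auto

text \<open>All index pairs split into the ordered ones, their mirror images and the diagonal. The
  minor is symmetric in the two indices and zero on the diagonal.\<close>

lemma sigma2_eq:
  fixes A :: "real^('n::{finite,linorder} + 'n)^('n + 'n)"
  assumes sym: "\<And>i j. A $ i $ j = A $ j $ i"
  shows "2 * sigma2 A = (trace A)\<^sup>2 - (\<Sum>j\<in>UNIV. \<Sum>i\<in>UNIV. (A $ i $ j)\<^sup>2)"
proof -
  define m where "m = (\<lambda>(i, j). A $ i $ i * A $ j $ j - (A $ i $ j)\<^sup>2)"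
  define L where "L = {(i, j). index_less i (j :: 'n + 'n)}"
  have "(\<Sum>q\<in>UNIV. m q) = (\<Sum>q\<in>L. m q) + (\<Sum>q\<in>- L. m q)"
    by (subst sum.union_disjoint[symmetric]) (auto simp: Un_commute intro!: sum.cong)
  also have "(\<Sum>q\<in>- L. m q) = (\<Sum>q\<in>prod.swap ` L. m q)"
  proof (rule sum.mono_neutral_right)
    show "prod.swap ` L \<subseteq> - L" by (auto simp: L_def dest: index_less_asym)
    show "\<forall>q \<in> - L - prod.swap ` L. m q = 0"
    proof
      fix q assume q: "q \<in> - L - prod.swap ` L"
      obtain i j where ij: "q = (i, j)" by (cases q)
      have "\<not> index_less j i"
      proof
        assume "index_less j i"
        then have "prod.swap (j, i) \<in> prod.swap ` L" by (intro imageI) (simp add: L_def)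
        then show False using q ij by simp
      qed
      then have "i = j" using q ij index_less_cases[of i j] by (auto simp: L_def)
      then show "m q = 0" using ij by (simp add: m_def power2_eq_square)
    qed
  qed auto
  also have "\<dots> = (\<Sum>q\<in>L. m q)"
    by (subst sum.reindex) (auto simp: m_def inj_on_def intro!: sum.cong arg_cong[where f = "\<lambda>x. x\<^sup>2"] sym)
  finally have "2 * sigma2 A = (\<Sum>q\<in>UNIV. m q)"
    by (simp add: sigma2_def m_def L_def)
  also have "\<dots> = (\<Sum>i\<in>UNIV. \<Sum>j\<in>UNIV. A $ i $ i * A $ j $ j - (A $ i $ j)\<^sup>2)"
    unfolding m_def UNIV_Times_UNIV[symmetric] sum.cartesian_product by simp
  also have "\<dots> = (trace A)\<^sup>2 - (\<Sum>i\<in>UNIV. \<Sum>j\<in>UNIV. (A $ i $ j)\<^sup>2)"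
    by (simp add: trace_def sum_subtractf power2_eq_square sum_product)
  also have "(\<Sum>i\<in>UNIV. \<Sum>j\<in>UNIV. (A $ i $ j)\<^sup>2) = (\<Sum>j\<in>UNIV. \<Sum>i\<in>UNIV. (A $ i $ j)\<^sup>2)"
    by (rule sum.swap)
  finally show ?thesis .
qed

text \<open>Cauchy-Schwarz over index pairs, applied to \<open>H\<close> and the rank-one matrix
  \<open>x i * x j\<close>. It turns a bound of the Frobenius norm by the trace into positivity of
  the Newton tensor.\<close>

lemma quadratic_form_le_frobenius:
  fixes H :: "'i::finite \<Rightarrow> 'i \<Rightarrow> real"
  assumes t: "0 \<le> t" and H: "(\<Sum>j\<in>UNIV. \<Sum>i\<in>UNIV. (H i j)\<^sup>2) \<le> t\<^sup>2"
  shows "(\<Sum>j\<in>UNIV. \<Sum>i\<in>UNIV. H i j * (x i * x j)) \<le> t * (\<Sum>i\<in>UNIV. (x i)\<^sup>2)"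
proof (rule power2_le_imp_le)
  have "(\<Sum>j\<in>UNIV. \<Sum>i\<in>UNIV. H i j * (x i * x j))\<^sup>2
      = (\<Sum>q\<in>UNIV \<times> UNIV. (\<lambda>(j, i). H i j) q * (\<lambda>(j, i). x i * x j) q)\<^sup>2"
    by (simp add: sum.cartesian_product case_prod_unfold)
  also have "\<dots> \<le> (\<Sum>q\<in>UNIV \<times> UNIV. ((\<lambda>(j, i). H i j) q)\<^sup>2) * (\<Sum>q\<in>UNIV \<times> UNIV. ((\<lambda>(j, i). x i * x j) q)\<^sup>2)"
    by (rule Cauchy_Schwarz_ineq_sum)
  also have "\<dots> = (\<Sum>j\<in>UNIV. \<Sum>i\<in>UNIV. (H i j)\<^sup>2) * (\<Sum>j\<in>UNIV. \<Sum>i\<in>UNIV. (x i * x j)\<^sup>2)"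
    by (simp add: sum.cartesian_product case_prod_unfold)
  also have "(\<Sum>j\<in>UNIV. \<Sum>i\<in>UNIV. (x i * x j)\<^sup>2) = (\<Sum>i\<in>UNIV. (x i)\<^sup>2)\<^sup>2"
    by (simp add: power_mult_distrib power2_eq_square[of "sum _ _"] sum_product mult.commute)
  also have "(\<Sum>j\<in>UNIV. \<Sum>i\<in>UNIV. (H i j)\<^sup>2) * (\<Sum>i\<in>UNIV. (x i)\<^sup>2)\<^sup>2 \<le> t\<^sup>2 * (\<Sum>i\<in>UNIV. (x i)\<^sup>2)\<^sup>2"
    by (intro mult_right_mono H) auto
  finally show "(\<Sum>j\<in>UNIV. \<Sum>i\<in>UNIV. H i j * (x i * x j))\<^sup>2 \<le> (t * (\<Sum>i\<in>UNIV. (x i)\<^sup>2))\<^sup>2"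
    by (simp add: power_mult_distrib)
  show "0 \<le> t * (\<Sum>i\<in>UNIV. (x i)\<^sup>2)" using t by (intro mult_nonneg_nonneg sum_nonneg) auto
qed

lemma C2_on_closureE:
  fixes u :: "'a::real_normed_vector \<Rightarrow> real"
  assumes "C2_on_closure S u"
  obtains u' u'' where "C2_with S u u' u''" "continuous_on (closure S) u"
    "continuous_on (closure S) u'" "continuous_on (closure S) u''"
proof -
  obtain u' :: "'a \<Rightarrow> 'a \<Rightarrow>\<^sub>L real" and u'' :: "'a \<Rightarrow> 'a \<Rightarrow>\<^sub>L 'a \<Rightarrow>\<^sub>L real" where
    u: "\<forall>z\<in>S. (u has_derivative blinfun_apply (u' z)) (at z)"
      "\<forall>z\<in>S. (u' has_derivative blinfun_apply (u'' z)) (at z)"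
      "continuous_on (closure S) u" "continuous_on (closure S) u'" "continuous_on (closure S) u''"
    using assms unfolding C2_on_closure_def by auto
  then have "C2_with S u u' u''"
    using continuous_on_subset[OF u(5) closure_subset] by (simp add: C2_with_def)
  then show thesis using u(3-5) by (rule that)
qed

lemma set_integrable_continuous_closure:
  fixes f :: "'a::euclidean_space \<Rightarrow> real"
  assumes "open S" "bounded S" "continuous_on (closure S) f"
  shows "set_integrable lborel S f"
proof (rule set_integrable_subset)
  show "set_integrable lborel (closure S) f"
    unfolding set_integrable_def using assms
    by (intro borel_integrable_compact) (auto simp: compact_closure)
qed (use assms closure_subset in auto)

lemma continuous_on_heis_vec [continuous_intros]: "continuous_on S (heis_vec i)"
  unfolding heis_vec_def[abs_def]
  by (intro continuous_intros linear_continuous_on bounded_linear_slope)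

lemma sum_antisym_mult_sym:
  fixes b M :: "'i::finite \<Rightarrow> 'i \<Rightarrow> real"
  assumes b: "\<And>i j. b j i = - b i j" and M: "\<And>i j. M i j = M j i"
  shows "(\<Sum>j\<in>UNIV. \<Sum>i\<in>UNIV. b i j * M i j) = 0"
proof -
  have "(\<Sum>j\<in>UNIV. \<Sum>i\<in>UNIV. b i j * M i j) = (\<Sum>i\<in>UNIV. \<Sum>j\<in>UNIV. b i j * M i j)"
    by (rule sum.swap)
  also have "\<dots> = (\<Sum>i\<in>UNIV. \<Sum>j\<in>UNIV. - (b j i * M j i))"
    using M by (intro sum.cong refl) (metis b minus_mult_left)
  finally show ?thesis by (simp add: sum_negf)
qed

lemma sum_sum_delta:
  fixes g :: "'i::finite \<Rightarrow> 'i \<Rightarrow> real"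
  shows "(\<Sum>j\<in>UNIV. \<Sum>i\<in>UNIV. (if i = j then c else 0) * g i j) = c * (\<Sum>j\<in>UNIV. g j j)"
proof -
  have "(\<Sum>i\<in>UNIV. (if i = j then c else 0) * g i j) = c * g j j" for j
    by (subst sum.remove[of _ j]) auto
  then show ?thesis by (simp add: sum_distrib_left)
qed

text \<open>Symmetric times symmetric parts polarize the quadratic form \<sigma>_2, antisymmetric
  times antisymmetric parts give the squares of \<open>p\<close> and \<open>q\<close>, and the mixed
  products sum to zero. \<open>P\<close>, \<open>Q\<close> stand for the Hessians of
  \<open>u\<close>, \<open>v\<close>, and \<open>p\<close>, \<open>q\<close> for their
  \<open>t\<close>-derivatives.\<close>

lemma sum_newton_polarization:
  fixes P Q b :: "'i::finite \<Rightarrow> 'i \<Rightarrow> real"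
  assumes P: "\<And>i j. P i j = P j i" and Q: "\<And>i j. Q i j = Q j i" and b: "\<And>i j. b j i = - b i j"
  shows "(\<Sum>j\<in>UNIV. \<Sum>i\<in>UNIV. ((if i = j then \<Sum>k\<in>UNIV. P k k + Q k k else 0) / 2
      - (P i j + Q i j) / 2 + 3 / 2 * b i j * (p + q)) * (P i j - Q i j + b i j * (p - q)))
    = (((\<Sum>k\<in>UNIV. P k k)\<^sup>2 - (\<Sum>j\<in>UNIV. \<Sum>i\<in>UNIV. (P i j)\<^sup>2)) / 2
        + 3 / 2 * (\<Sum>j\<in>UNIV. \<Sum>i\<in>UNIV. (b i j)\<^sup>2) * p\<^sup>2)
    - (((\<Sum>k\<in>UNIV. Q k k)\<^sup>2 - (\<Sum>j\<in>UNIV. \<Sum>i\<in>UNIV. (Q i j)\<^sup>2)) / 2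
        + 3 / 2 * (\<Sum>j\<in>UNIV. \<Sum>i\<in>UNIV. (b i j)\<^sup>2) * q\<^sup>2)"
proof -
  define t where "t = (\<Sum>k\<in>UNIV. P k k + Q k k)"
  have b0: "b j j = 0" for j using b[of j j] by simp
  have split: "((if i = j then t else 0) / 2 - (P i j + Q i j) / 2 + 3 / 2 * b i j * (p + q))
        * (P i j - Q i j + b i j * (p - q))
      = (if i = j then t / 2 else 0) * (P i j - Q i j + b i j * (p - q))
        - (P i j)\<^sup>2 / 2 + (Q i j)\<^sup>2 / 2
        + b i j * ((3 / 2 * (p + q)) * (P i j - Q i j) - (p - q) / 2 * (P i j + Q i j))
        + 3 / 2 * (p\<^sup>2 - q\<^sup>2) * (b i j)\<^sup>2" for i j
    by (auto simp: power2_eq_square field_simps)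
  have "(\<Sum>j\<in>UNIV. \<Sum>i\<in>UNIV. b i j * ((3 / 2 * (p + q)) * (P i j - Q i j) - (p - q) / 2 * (P i j + Q i j))) = 0"
    by (rule sum_antisym_mult_sym[OF b]) (metis P Q)
  then show ?thesis
    unfolding t_def[symmetric] split
    by (simp add: sum.distrib sum_subtractf sum_sum_delta b0 sum_distrib_left[symmetric]
        sum_divide_distrib[symmetric]) (simp add: t_def sum.distrib power2_eq_square field_simps)
qed

text \<open>
  The symmetric part is half the Newton tensor \<open>tr H I - H\<close> of \<open>\<sigma>\<^sub>2\<close>. Its divergence along the
  noncommuting fields does not vanish; the antisymmetric multiple of \<open>\<partial>\<^sub>t U\<close> compensates exactly for
  that and produces the term \<open>12 n (\<partial>\<^sub>t u)\<^sup>2\<close>.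
\<close>

definition div_free_tensor ::
    "('n::finite heis \<Rightarrow> 'n heis \<Rightarrow>\<^sub>L real) \<Rightarrow> ('n heis \<Rightarrow> 'n heis \<Rightarrow>\<^sub>L 'n heis \<Rightarrow>\<^sub>L real) \<Rightarrow>
      'n + 'n \<Rightarrow> 'n + 'n \<Rightarrow> 'n heis \<Rightarrow> real" where
  "div_free_tensor U' U'' i j z =
    (if i = j then \<Sum>k\<in>UNIV. U'' z (heis_vec k z) (heis_vec k z) else 0) / 2
    - U'' z (heis_vec i z) (heis_vec j z) / 2 + 3 / 2 * slope j (base i) * U' z vert"

text \<open>Swapping the fields \<open>i\<close> and \<open>j\<close> between the derivative of
  \<open>U\<close> along field \<open>i\<close> and \<psi> leaves a commutator term, namely
  \<open>slope j (base i)\<close> times the integral of \<open>f' i z vert * \<psi> z\<close> after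
  halving. Integrating the \<partial>_t \<open>U\<close> term by parts gives the same with the
  opposite sign.\<close>

lemma integral_div_free_tensor_eq_0:
  assumes "test_function S K \<psi> \<psi>'" and C: "C2_with S U U' U''"
  shows "(LINT z|lborel. (\<Sum>i\<in>UNIV. div_free_tensor U' U'' i j z * \<psi>' z (heis_vec i z))) = 0"
proof -
  interpret test_function S K \<psi> \<psi>' by fact
  define f' where "f' i z h = U'' z h (heis_vec i z) + slope i h * U' z vert" for i z h
  have f: "C1_with S (\<lambda>z. U' z (heis_vec i z)) (f' i)" for i
    unfolding f'_def[abs_def] by (rule C2_with_field[OF C])
  note U = C2_with_imp_C1_with(1)[OF C]
  define sw where "sw i z = f' i z (heis_vec i z) * \<psi>' z (heis_vec j z)
    - f' i z (heis_vec j z) * \<psi>' z (heis_vec i z)" for i z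
  have sw: "integrable lborel (sw i)"
    "(LINT z|lborel. sw i z) = 2 * slope j (base i) * (LINT z|lborel. f' i z vert * \<psi> z)" for i
    using integral_field_swap[OF f[of i] bounded_linear_slope slope_vert bounded_linear_slope slope_vert,
        of "base i" i "base j" j] slope_base_antisym[of i j]
    unfolding sw_def[abs_def] heis_vec_def by simp_all
  have int_vert: "integrable lborel (\<lambda>z. U' z (heis_vec i z) * \<psi>' z vert)" for i
    by (rule integrable(2)[OF C1_with_cont[OF f]])
  have ibp: "(LINT z|lborel. U' z (heis_vec i z) * \<psi>' z vert) = - (LINT z|lborel. f' i z vert * \<psi> z)" for i
    by (rule integral_by_parts[OF f])
  \<comment> \<open>\<partial>_t is the field with base \<open>vert\<close> and slope zero, and it
    commutes with every Heisenberg field.\<close>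
  have "integrable lborel (\<lambda>z. U' z (heis_vec i z) * \<psi>' z vert - U' z vert * \<psi>' z (heis_vec i z))"
    "(LINT z|lborel. U' z (heis_vec i z) * \<psi>' z vert - U' z vert * \<psi>' z (heis_vec i z)) = 0" for i
    using integral_field_swap[OF U bounded_linear_slope slope_vert bounded_linear_zero refl,
        of "base i" i vert] by (simp_all add: heis_vec_def)
  note swv = this
  have v: "integrable lborel (\<lambda>z. U' z vert * \<psi>' z (heis_vec i z))"
    "(LINT z|lborel. U' z vert * \<psi>' z (heis_vec i z)) = - (LINT z|lborel. f' i z vert * \<psi> z)" for i
  proof -
    show *: "integrable lborel (\<lambda>z. U' z vert * \<psi>' z (heis_vec i z))"
      using Bochner_Integration.integrable_diff[OF int_vert swv(1), of i i] by simp
    show "(LINT z|lborel. U' z vert * \<psi>' z (heis_vec i z)) = - (LINT z|lborel. f' i z vert * \<psi> z)"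
      using swv(2)[of i] Bochner_Integration.integral_diff[OF int_vert *] ibp[of i] by simp
  qed
  have eq: "(\<Sum>i\<in>UNIV. div_free_tensor U' U'' i j z * \<psi>' z (heis_vec i z))
      = (\<Sum>i\<in>UNIV. sw i z / 2 + slope j (base i) * (U' z vert * \<psi>' z (heis_vec i z)))" for z
  proof (cases "z \<in> K")
    case True
    then have z: "z \<in> S" using KS by auto
    define H where "H i k = U'' z (heis_vec i z) (heis_vec k z)" for i k
    have H: "H i k = H k i" for i k
      unfolding H_def by (rule C2_with_symmetric[OF C S z])
    have b0: "slope i (base i) = 0" for i using slope_base_antisym[of i i] by simp
    have "(\<Sum>i\<in>UNIV. (if i = j then \<Sum>k\<in>UNIV. H k k else 0) / 2 * \<psi>' z (heis_vec i z))
        = (\<Sum>i\<in>UNIV. if i = j then (\<Sum>k\<in>UNIV. H k k) / 2 * \<psi>' z (heis_vec j z) else 0)"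
      by (intro sum.cong) auto
    then have "(\<Sum>i\<in>UNIV. (if i = j then \<Sum>k\<in>UNIV. H k k else 0) / 2 * \<psi>' z (heis_vec i z))
        = (\<Sum>i\<in>UNIV. H i i / 2 * \<psi>' z (heis_vec j z))"
      by (simp add: sum_distrib_right[symmetric] sum_divide_distrib[symmetric])
    then have "(\<Sum>i\<in>UNIV. div_free_tensor U' U'' i j z * \<psi>' z (heis_vec i z))
        = (\<Sum>i\<in>UNIV. H i i / 2 * \<psi>' z (heis_vec j z)
            - H i j / 2 * \<psi>' z (heis_vec i z) + 3 / 2 * slope j (base i) * U' z vert * \<psi>' z (heis_vec i z))"
      unfolding div_free_tensor_def H_def[symmetric] distrib_right left_diff_distrib sum.distrib sum_subtractf
      by simp
    also have "\<dots> = (\<Sum>i\<in>UNIV. sw i z / 2 + slope j (base i) * (U' z vert * \<psi>' z (heis_vec i z)))"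
    proof (intro sum.cong refl)
      fix i
      \<comment> \<open>\<open>f' i z (heis_vec j z)\<close> is an iterated derivative of
        \<open>U\<close> and differs from the symmetric \<open>H i j\<close> by a multiple of
        \<partial>_t \<open>U\<close>. This uses 1/2 of the coefficient 3/2; the remaining 1 is what
        cancels the commutator.\<close>
      have "sw i z = H i i * \<psi>' z (heis_vec j z)
          - (H i j - slope j (base i) * U' z vert) * \<psi>' z (heis_vec i z)"
        using H[of i j] slope_base_antisym[of j i] by (simp add: sw_def f'_def H_def b0)
      then show "H i i / 2 * \<psi>' z (heis_vec j z) - H i j / 2 * \<psi>' z (heis_vec i z)
            + 3 / 2 * slope j (base i) * U' z vert * \<psi>' z (heis_vec i z)
          = sw i z / 2 + slope j (base i) * (U' z vert * \<psi>' z (heis_vec i z))"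
        by (simp add: field_simps)
    qed
    finally show ?thesis .
  qed (simp add: deriv_zero sw_def)
  show ?thesis
    unfolding eq using sw v by (simp add: Bochner_Integration.integral_sum)
qed

text \<open>The antisymmetric part drops out of the quadratic form, and the Frobenius bound controls
  the rest.\<close>

lemma div_free_tensor_nonneg:
  fixes U'' :: "'n::finite heis \<Rightarrow> 'n heis \<Rightarrow>\<^sub>L 'n heis \<Rightarrow>\<^sub>L real"
  assumes tr: "0 \<le> (\<Sum>k\<in>UNIV. U'' z (heis_vec k z) (heis_vec k z))"
    and frob: "(\<Sum>j\<in>UNIV. \<Sum>i\<in>UNIV. (U'' z (heis_vec i z) (heis_vec j z))\<^sup>2)
      \<le> (\<Sum>k\<in>UNIV. U'' z (heis_vec k z) (heis_vec k z))\<^sup>2"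
  shows "0 \<le> (\<Sum>j\<in>UNIV. \<Sum>i\<in>UNIV. div_free_tensor U' U'' i j z * (x i * x j))"
proof -
  define H where "H i k = U'' z (heis_vec i z) (heis_vec k z)" for i k
  define t where "t = (\<Sum>k\<in>UNIV. H k k)"
  have split: "div_free_tensor U' U'' i j z * (x i * x j)
      = (if i = j then t / 2 else 0) * (x i * x j) - H i j * (x i * x j) / 2
        + slope j (base i) * ((3 / 2 * U' z vert) * (x i * x j))" for i j
    by (simp add: div_free_tensor_def H_def t_def field_simps)
  have "(\<Sum>j\<in>UNIV. \<Sum>i\<in>UNIV. slope j (base i) * ((3 / 2 * U' z vert) * (x i * x j))) = 0"
    by (rule sum_antisym_mult_sym[OF slope_base_antisym]) (simp add: mult.commute)
  then have "(\<Sum>j\<in>UNIV. \<Sum>i\<in>UNIV. div_free_tensor U' U'' i j z * (x i * x j))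
      = (t * (\<Sum>j\<in>UNIV. (x j)\<^sup>2) - (\<Sum>j\<in>UNIV. \<Sum>i\<in>UNIV. H i j * (x i * x j))) / 2"
    unfolding split
    by (simp add: sum.distrib sum_subtractf sum_sum_delta sum_divide_distrib[symmetric]
        power2_eq_square diff_divide_distrib)
  moreover have "(\<Sum>j\<in>UNIV. \<Sum>i\<in>UNIV. H i j * (x i * x j)) \<le> t * (\<Sum>j\<in>UNIV. (x j)\<^sup>2)"
    using tr frob unfolding t_def H_def by (intro quadratic_form_le_frobenius)
  ultimately show ?thesis by simp
qed

lemma trace_heis_hessian:
  assumes "C2_with S u u' u''" "open S" "z \<in> S"
  shows "trace (heis_hessian u z) = (\<Sum>k\<in>UNIV. u'' z (heis_vec k z) (heis_vec k z))"
  by (simp add: trace_def C2_with_heis_hessian[OF assms])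

lemma sigma2_heis_hessian:
  fixes u :: "'n::{finite,linorder} heis \<Rightarrow> real"
  assumes "C2_with S u u' u''" "open S" "z \<in> S"
  shows "sigma2 (heis_hessian u z)
    = ((\<Sum>k\<in>UNIV. u'' z (heis_vec k z) (heis_vec k z))\<^sup>2
      - (\<Sum>j\<in>UNIV. \<Sum>i\<in>UNIV. (u'' z (heis_vec i z) (heis_vec j z))\<^sup>2)) / 2"
proof -
  have "heis_hessian u z $ i $ j = heis_hessian u z $ j $ i" for i j
    by (simp add: heis_hessian_def add.commute)
  from sigma2_eq[OF this] show ?thesis
    by (simp add: trace_heis_hessian[OF assms] C2_with_heis_hessian[OF assms])
qed

section \<open>The two integral inequalities\<close>

theorem theorem3p1:
  fixes \<Omega> :: "'n::{finite,linorder} heis set" and u v :: "'n heis \<Rightarrow> real"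
  assumes "open \<Omega>" and "bounded \<Omega>"
    and "C2_on_closure \<Omega> u" and "C2_on_closure \<Omega> v"
    and "sigma2_convex \<Omega> (\<lambda>z. u z + v z)"
    and "\<And>z. z \<in> frontier \<Omega> \<Longrightarrow> v z = u z"
    and "\<And>z. z \<in> \<Omega> \<Longrightarrow> v z < u z"
  shows "(LINT z:\<Omega>|lborel. sigma2 (heis_hessian u z) + 12 * real CARD('n) * (dt u z)\<^sup>2)
           \<le> (LINT z:\<Omega>|lborel. sigma2 (heis_hessian v z) + 12 * real CARD('n) * (dt v z)\<^sup>2)
         \<and> (LINT z:\<Omega>|lborel. trace (heis_hessian u z))
              \<le> (LINT z:\<Omega>|lborel. trace (heis_hessian v z))"
proof -
  note \<Omega> = \<open>open \<Omega>\<close> \<open>bounded \<Omega>\<close>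
  have meas: "\<Omega> \<in> sets lborel" using \<Omega> by simp
  obtain u' u'' where u: "C2_with \<Omega> u u' u''" and cu: "continuous_on (closure \<Omega>) u"
    "continuous_on (closure \<Omega>) u'" "continuous_on (closure \<Omega>) u''"
    using \<open>C2_on_closure \<Omega> u\<close> by (rule C2_on_closureE)
  obtain v' v'' where v: "C2_with \<Omega> v v' v''" and cv: "continuous_on (closure \<Omega>) v"
    "continuous_on (closure \<Omega>) v'" "continuous_on (closure \<Omega>) v''"
    using \<open>C2_on_closure \<Omega> v\<close> by (rule C2_on_closureE)
  define U' U'' where "U' z = u' z + v' z" and "U'' z = u'' z + v'' z" for z
  define w' w'' where "w' z = u' z - v' z" and "w'' z = u'' z - v'' z" for z
  have U: "C2_with \<Omega> (\<lambda>z. u z + v z) U' U''"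
    unfolding U'_def[abs_def] U''_def[abs_def] by (rule C2_with_add[OF u v])
  have w: "C2_with \<Omega> (\<lambda>z. u z - v z) w' w''"
    unfolding w'_def[abs_def] w''_def[abs_def] by (rule C2_with_diff[OF u v])
  define w2 where "w2 j z h = w'' z h (heis_vec j z) + slope j h * w' z vert" for j z h
  have w2: "w2 j z (heis_vec i z) = u'' z (heis_vec i z) (heis_vec j z) - v'' z (heis_vec i z) (heis_vec j z)
      + slope j (base i) * (u' z vert - v' z vert)" for i j z
    by (simp add: w2_def w'_def w''_def blinfun.bilinear_simps)
  have Vw: "C1_with \<Omega> (\<lambda>z. w' z (heis_vec j z)) (w2 j)" for j
    unfolding w2_def[abs_def] by (rule C2_with_field[OF w])
  have cw: "continuous_on (closure \<Omega>) (\<lambda>z. u z - v z)" using cu cv by (intro continuous_intros)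
  have w0: "u z - v z = 0" if "z \<in> frontier \<Omega>" for z using assms(6)[OF that] by simp
  have w_pos: "0 < u z - v z" if "z \<in> \<Omega>" for z using assms(7)[OF that] by simp
  \<comment> \<open>Everything concerning the fields and \<open>w\<close> is fixed here; the matrix
    stays free, to be the divergence-free tensor first and the identity afterwards.\<close>
  note nonpos = integral_divergence_form_nonpos
    [where a = base and p = slope and e = vert, folded heis_vec_def,
      OF \<Omega> bounded_linear_slope C2_with_imp_C1_with(1)[OF w] cw w0 w_pos Vw]

  \<comment> \<open>\<open>F\<close> and \<open>G\<close> express the integrands through the
    extended derivatives. They are therefore continuous on the compact closure, which gives
    integrability, and agree with the original integrands in \<Omega>.\<close>
  define F where "F u' u'' z = ((\<Sum>k\<in>UNIV. u'' z (heis_vec k z) (heis_vec k z))\<^sup>2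
      - (\<Sum>j\<in>UNIV. \<Sum>i\<in>UNIV. (u'' z (heis_vec i z) (heis_vec j z))\<^sup>2)) / 2
      + 12 * real CARD('n) * (u' z vert)\<^sup>2"
    for u' :: "'n heis \<Rightarrow> 'n heis \<Rightarrow>\<^sub>L real" and u'' :: "'n heis \<Rightarrow> 'n heis \<Rightarrow>\<^sub>L 'n heis \<Rightarrow>\<^sub>L real" and z
  define G where "G u'' z = (\<Sum>k\<in>UNIV. u'' z (heis_vec k z) (heis_vec k z))"
    for u'' :: "'n heis \<Rightarrow> 'n heis \<Rightarrow>\<^sub>L 'n heis \<Rightarrow>\<^sub>L real" and z
  have intF: "set_integrable lborel \<Omega> (F u' u'')" "set_integrable lborel \<Omega> (F v' v'')"
    unfolding F_def[abs_def]
    by (intro set_integrable_continuous_closure \<Omega> continuous_intros cu cv; simp)+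
  have intG: "set_integrable lborel \<Omega> (G u'')" "set_integrable lborel \<Omega> (G v'')"
    unfolding G_def[abs_def]
    by (intro set_integrable_continuous_closure \<Omega> continuous_intros cu cv)+

  have L1: "(\<Sum>j\<in>UNIV. \<Sum>i\<in>UNIV. div_free_tensor U' U'' i j z * w2 j z (heis_vec i z))
      = F u' u'' z - F v' v'' z" if z: "z \<in> \<Omega>" for z
  proof -
    have "div_free_tensor U' U'' i j z * w2 j z (heis_vec i z)
      = ((if i = j then \<Sum>k\<in>UNIV. u'' z (heis_vec k z) (heis_vec k z) + v'' z (heis_vec k z) (heis_vec k z) else 0) / 2
        - (u'' z (heis_vec i z) (heis_vec j z) + v'' z (heis_vec i z) (heis_vec j z)) / 2
        + 3 / 2 * slope j (base i) * (u' z vert + v' z vert))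
        * (u'' z (heis_vec i z) (heis_vec j z) - v'' z (heis_vec i z) (heis_vec j z)
          + slope j (base i) * (u' z vert - v' z vert))" for i j
      unfolding w2 div_free_tensor_def U'_def U''_def by (simp add: blinfun.bilinear_simps)
    then have "(\<Sum>j\<in>UNIV. \<Sum>i\<in>UNIV. div_free_tensor U' U'' i j z * w2 j z (heis_vec i z))
      = (((\<Sum>k\<in>UNIV. u'' z (heis_vec k z) (heis_vec k z))\<^sup>2
          - (\<Sum>j\<in>UNIV. \<Sum>i\<in>UNIV. (u'' z (heis_vec i z) (heis_vec j z))\<^sup>2)) / 2
          + 3 / 2 * (8 * real CARD('n)) * (u' z vert)\<^sup>2)
        - (((\<Sum>k\<in>UNIV. v'' z (heis_vec k z) (heis_vec k z))\<^sup>2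
          - (\<Sum>j\<in>UNIV. \<Sum>i\<in>UNIV. (v'' z (heis_vec i z) (heis_vec j z))\<^sup>2)) / 2
          + 3 / 2 * (8 * real CARD('n)) * (v' z vert)\<^sup>2)"
      using sum_newton_polarization
        [where P = "\<lambda>i j. u'' z (heis_vec i z) (heis_vec j z)" and Q = "\<lambda>i j. v'' z (heis_vec i z) (heis_vec j z)"
          and b = "\<lambda>i j. slope j (base i)" and p = "u' z vert" and q = "v' z vert",
          OF C2_with_symmetric[OF u \<Omega>(1) z] C2_with_symmetric[OF v \<Omega>(1) z] slope_base_antisym]
      unfolding sum_slope_base_power2 by presburger
    then show ?thesis by (simp add: F_def)
  qed
  \<comment> \<open>The first-order terms disappear because the diagonal numbers
    \<open>slope j (base j)\<close> are zero.\<close>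
  have L2: "(\<Sum>j\<in>UNIV. \<Sum>i\<in>UNIV. (if i = j then 1 else 0) * w2 j z (heis_vec i z))
      = G u'' z - G v'' z" for z
  proof -
    have "slope j (base j) = 0" for j :: "'n + 'n" using slope_base_antisym[of j j] by simp
    then show ?thesis by (simp add: sum_sum_delta w2 G_def sum_subtractf)
  qed

  have "(LINT z:\<Omega>|lborel. \<Sum>j\<in>UNIV. \<Sum>i\<in>UNIV. div_free_tensor U' U'' i j z * w2 j z (heis_vec i z)) \<le> 0"
  proof (rule nonpos)
    show "continuous_on \<Omega> (div_free_tensor U' U'' i j)" for i j
      unfolding div_free_tensor_def[abs_def] U'_def U''_def
      by (cases "i = j"; simp; intro continuous_intros continuous_on_subset[OF cu(2) closure_subset]
          continuous_on_subset[OF cu(3) closure_subset] continuous_on_subset[OF cv(2) closure_subset]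
          continuous_on_subset[OF cv(3) closure_subset]; simp)
    \<comment> \<open>Nonnegative \<open>sigma2\<close> says exactly that the squared Frobenius norm
      of the Hessian of the sum of \<open>u\<close> and \<open>v\<close> is at most the squared
      trace.\<close>
    show "0 \<le> (\<Sum>j\<in>UNIV. \<Sum>i\<in>UNIV. div_free_tensor U' U'' i j z * (x i * x j))" if z: "z \<in> \<Omega>" for z x
      using \<open>sigma2_convex \<Omega> (\<lambda>z. u z + v z)\<close> z
      unfolding sigma2_convex_def
      by (intro div_free_tensor_nonneg)
         (auto simp: trace_heis_hessian[OF U \<Omega>(1) z] sigma2_heis_hessian[OF U \<Omega>(1) z])
    show "set_integrable lborel \<Omega>
        (\<lambda>z. \<Sum>j\<in>UNIV. \<Sum>i\<in>UNIV. div_free_tensor U' U'' i j z * w2 j z (heis_vec i z))"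
      using set_integral_diff(1)[OF intF]
      by (subst set_integrable_cong[OF refl refl L1]) auto
  qed (assumption | rule integral_div_free_tensor_eq_0[OF _ U])+
  also have "(LINT z:\<Omega>|lborel. \<Sum>j\<in>UNIV. \<Sum>i\<in>UNIV. div_free_tensor U' U'' i j z * w2 j z (heis_vec i z))
      = (LINT z:\<Omega>|lborel. F u' u'' z) - (LINT z:\<Omega>|lborel. F v' v'' z)"
    using set_integral_diff(2)[OF intF] by (subst set_lebesgue_integral_cong[OF meas]) (use L1 in auto)
  finally have 1: "(LINT z:\<Omega>|lborel. F u' u'' z) \<le> (LINT z:\<Omega>|lborel. F v' v'' z)" by simp

  have "(LINT z:\<Omega>|lborel. \<Sum>j\<in>UNIV. \<Sum>i\<in>UNIV. (if i = j then 1 else 0) * w2 j z (heis_vec i z)) \<le> 0"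
  proof (rule nonpos)
    show "0 \<le> (\<Sum>j\<in>UNIV. \<Sum>i\<in>UNIV. (if i = j then 1 else 0) * (x i * x j))" for x :: "'n + 'n \<Rightarrow> real"
      by (simp only: sum_sum_delta) (simp add: sum_nonneg)
    show "set_integrable lborel \<Omega>
        (\<lambda>z. \<Sum>j\<in>UNIV. \<Sum>i\<in>UNIV. (if i = j then 1 else 0) * w2 j z (heis_vec i z))"
      unfolding L2 by (rule set_integral_diff(1)[OF intG])
    \<comment> \<open>For the identity matrix, zero weak divergence means that each Heisenberg field
      is itself divergence free.\<close>
    show "(LINT z|lborel. (\<Sum>i\<in>UNIV. (if i = j then 1 else 0) * \<psi>' z (heis_vec i z))) = 0"
      if "test_function \<Omega> K \<psi> \<psi>'" for K \<psi> \<psi>' j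
    proof -
      have "(\<Sum>i\<in>UNIV. (if i = j then 1 else 0) * \<psi>' z (heis_vec i z)) = \<psi>' z (heis_vec j z)" for z
        by (subst sum.remove[of _ j]) auto
      then show ?thesis
        using test_function.integral_deriv_field_eq_0[OF that bounded_linear_slope slope_vert,
            of "base j" j]
        by (simp add: heis_vec_def)
    qed
  qed (assumption | rule continuous_on_const)+
  then have 2: "(LINT z:\<Omega>|lborel. G u'' z) \<le> (LINT z:\<Omega>|lborel. G v'' z)"
    unfolding L2 set_integral_diff(2)[OF intG] by simp

  have "(LINT z:\<Omega>|lborel. sigma2 (heis_hessian f z) + 12 * real CARD('n) * (dt f z)\<^sup>2)
      = (LINT z:\<Omega>|lborel. F f' f'' z)"
    "(LINT z:\<Omega>|lborel. trace (heis_hessian f z)) = (LINT z:\<Omega>|lborel. G f'' z)"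
    if f: "C2_with \<Omega> f f' f''" for f f' f''
    by (intro set_lebesgue_integral_cong meas allI impI;
        simp add: sigma2_heis_hessian[OF f \<Omega>(1)] trace_heis_hessian[OF f \<Omega>(1)]
          C2_with_dt[OF f] F_def G_def)+
  from this[OF u] this[OF v] 1 2 show ?thesis by simp
qed

end
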